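(* Consider the D1Q3 scheme à la Lax–Wendroff of the context with $\mathscr{C}\in(-1,0)\cup(0,1)$, $s_2,s_3\in(0,2)$ and $s_3\leq s_3^\star(s_2)$. Then, with the classification labels of the context: for $\mathscr{C}<0$: bounce-back MU-L; anti-bounce-back SS; two-steps anti-bounce-back SS; extrapolation with $1\leq\sigma\leq4$ SS; kinetic Dirichlet SS; for $\mathscr{C}>0$: bounce-back SS; anti-bounce-back SS; two-steps anti-bounce-back SS; extrapolation with $1\leq\sigma\leq4$ MU-E; kinetic Dirichlet SS.
   Context: Grid: $x_j=j\Delta x$, $j\in\mathbb{N}$ (ghost point $j=-1$), $\Delta t=\Delta x/\lambda$, $\lambda>0$, Courant number $\mathscr{C}=V/\lambda$. Distribution functions $f_1,f_2,f_3$ with velocities $c_1=0$, $c_2=1$, $c_3=-1$; moments $m_1=f_1+f_2+f_3$, $m_2=f_2-f_3$, $m_3=f_2+f_3$. Relaxation at every $j\in\mathbb{N}$: $m_1^\star=m_1$, $m_2^\star=(1-s_2)m_2+s_2\mathscr{C}m_1$, $m_3^\star=(1-s_3)m_3+s_3\mathscr{C}^2m_1$, then $f^\star$ recovered from $m^\star$. Transport: $f^{n+1}_{1,j}=f^{n\star}_{1,j}$, $f^{n+1}_{2,j}=f^{n\star}_{2,j-1}$, $f^{n+1}_{3,j}=f^{n\star}_{3,j+1}$, $j\in\mathbb{N}$. Zero initial data. Stability threshold: $s_3^\star(s):=1+\frac{\sqrt{(s^2-8s+8)^2+4s^2(2-s)^2}-2s(2-s)}{s^2-8s+8}$ if $s\neq3-2\sqrt2$,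 and $s_3^\star(3-2\sqrt2):=1$. Boundary conditions (source $g^n_{2,-1}$): bounce-back $f^{n\star}_{2,-1}=f^{n\star}_{3,0}+g^n_{2,-1}$; anti-bounce-back $f^{n\star}_{2,-1}=-f^{n\star}_{3,0}+g^n_{2,-1}$; two-steps anti-bounce-back $f^{n\star}_{2,-1}=-f^{n\star}_{1,0}-f^{n\star}_{3,1}+g^n_{2,-1}$; extrapolation of order $\sigma$: $f^{n\star}_{2,-1}=\sum_{j=0}^{\sigma-1}(-1)^j\binom{\sigma}{j+1}f^{n\star}_{2,j}+g^n_{2,-1}$; kinetic Dirichlet $f^{n\star}_{2,-1}=g^n_{2,-1}$. SS estimate: there is $C>0$ such that for all $\alpha>0$, all sources and all $\Delta x>0$: $\frac{\alpha}{1+\alpha\Delta t}\sum_{n,j\in\mathbb{N}}\Delta t\Delta x\,e^{-2\alpha n\Delta t}|m^n_j|^2\leq C\sum_{n}\Delta t\,e^{-2\alpha n\Delta t}(g^n_{2,-1})^2$ ($m^n_j\in\mathbb{R}^3$); SSOO estimate: the same with $(m^n_{1,j})^2$ on the left. Labels: SS = SS estimate holds; SSOO = SSOO holds but SS fails; MU-L/MU-E = neither holds, the instability being produced by a critical mode $(z,\kappa)$ shared by the bulk and boundary schemes (κ the limit of the stable spatial root) with $|z|=1$ and $|\kappa|<1$ (L) or $|\kappa|=1$ (E). *)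

theory Defs
  imports "HOL-Analysis.Analysis"
begin

text \<open>Distribution functions at a node: triple (f1, f2, f3), velocities 0, 1, -1.\<close>

definition f1 :: "'a \<times> 'a \<times> 'a \<Rightarrow> 'a" where "f1 F = fst F"
definition f2 :: "'a \<times> 'a \<times> 'a \<Rightarrow> 'a" where "f2 F = fst (snd F)"
definition f3 :: "'a \<times> 'a \<times> 'a \<Rightarrow> 'a" where "f3 F = snd (snd F)"

definition smul3 :: "'a::times \<Rightarrow> 'a \<times> 'a \<times> 'a \<Rightarrow> 'a \<times> 'a \<times> 'a" where
  "smul3 c F = (c * f1 F, c * f2 F, c * f3 F)"

definition moments :: "'a::comm_ring \<times> 'a \<times> 'a \<Rightarrow> 'a \<times> 'a \<times> 'a" where
  "moments F = (f1 F + f2 F + f3 F, f2 F - f3 F, f2 F + f3 F)"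

text \<open>Relaxation: m1* = m1, m2* = (1-s2) m2 + s2 C m1, m3* = (1-s3) m3 + s3 C^2 m1,
  then f* recovered from m*: f1 = m1 - m3, f2 = (m3+m2)/2, f3 = (m3-m2)/2.\<close>
definition relax :: "'a::field \<Rightarrow> 'a \<Rightarrow> 'a \<Rightarrow> 'a \<times> 'a \<times> 'a \<Rightarrow> 'a \<times> 'a \<times> 'a" where
  "relax C s2 s3 F =
    (let m = moments F; m1 = f1 m; m2 = f2 m; m3 = f3 m;
         m2s = (1 - s2) * m2 + s2 * C * m1;
         m3s = (1 - s3) * m3 + s3 * C^2 * m1
     in (m1 - m3s, (m3s + m2s) / 2, (m3s - m2s) / 2))"

datatype bc = BounceBack | AntiBounceBack | TwoStepsAntiBounceBack
  | Extrapolation nat | KineticDirichlet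

text \<open>Value of f*_{2,-1} given by the boundary condition, without the source term,
  as a function of the post-collision field fs (fs j = f*_j, j in N).\<close>
fun ghost :: "bc \<Rightarrow> (nat \<Rightarrow> 'a::comm_ring_1 \<times> 'a \<times> 'a) \<Rightarrow> 'a" where
  "ghost BounceBack fs = f3 (fs 0)"
| "ghost AntiBounceBack fs = - f3 (fs 0)"
| "ghost TwoStepsAntiBounceBack fs = - f1 (fs 0) - f3 (fs 1)"
| "ghost (Extrapolation \<sigma>) fs =
     (\<Sum>j<\<sigma>. (-1)^j * of_nat (\<sigma> choose (j+1)) * f2 (fs j))"
| "ghost KineticDirichlet fs = 0"

primrec lbm :: "bc \<Rightarrow> real \<Rightarrow> real \<Rightarrow> real \<Rightarrow> (nat \<Rightarrow> real) \<Rightarrow> nat \<Rightarrow> nat \<Rightarrow> real \<times> real \<times> real" where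
  "lbm b C s2 s3 g 0 = (\<lambda>j. (0, 0, 0))"
| "lbm b C s2 s3 g (Suc n) =
    (let fs = (\<lambda>j. relax C s2 s3 (lbm b C s2 s3 g n j));
         gh = ghost b fs + g n
     in (\<lambda>j. (f1 (fs j), (if j = 0 then gh else f2 (fs (j - 1))), f3 (fs (Suc j)))))"

definition msq :: "real \<times> real \<times> real \<Rightarrow> real" where
  "msq m = (f1 m)^2 + (f2 m)^2 + (f3 m)^2"

text \<open>SS estimate (lam = lattice velocity \<lambda>, \<Delta>t = \<Delta>x / lam).\<close>
definition SS_estimate :: "bc \<Rightarrow> real \<Rightarrow> real \<Rightarrow> real \<Rightarrow> real \<Rightarrow> bool" where
  "SS_estimate b C s2 s3 lam \<longleftrightarrow>
    (\<exists>K>0. \<forall>\<alpha>>0. \<forall>g. \<forall>dx>0.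
       ennreal (\<alpha> / (1 + \<alpha> * (dx / lam))) *
         (\<Sum>n. \<Sum>j. ennreal ((dx / lam) * dx * exp (- 2 * \<alpha> * real n * (dx / lam))
                    * msq (moments (lbm b C s2 s3 g n j))))
       \<le> ennreal K * (\<Sum>n. ennreal ((dx / lam) * exp (- 2 * \<alpha> * real n * (dx / lam)) * (g n)^2)))"

definition SSOO_estimate :: "bc \<Rightarrow> real \<Rightarrow> real \<Rightarrow> real \<Rightarrow> real \<Rightarrow> bool" where
  "SSOO_estimate b C s2 s3 lam \<longleftrightarrow>
    (\<exists>K>0. \<forall>\<alpha>>0. \<forall>g. \<forall>dx>0.
       ennreal (\<alpha> / (1 + \<alpha> * (dx / lam))) *
         (\<Sum>n. \<Sum>j. ennreal ((dx / lam) * dx * exp (- 2 * \<alpha> * real n * (dx / lam))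
                    * (f1 (moments (lbm b C s2 s3 g n j)))^2))
       \<le> ennreal K * (\<Sum>n. ennreal ((dx / lam) * exp (- 2 * \<alpha> * real n * (dx / lam)) * (g n)^2)))"

text \<open>Normal modes f^n_j = z^n kappa^j F of the bulk scheme (complexified):
  z F1 = (MF)_1, z F2 = kappa^{-1} (MF)_2, z F3 = kappa (MF)_3, written without division.\<close>
definition bulk_mode :: "real \<Rightarrow> real \<Rightarrow> real \<Rightarrow> complex \<Rightarrow> complex \<Rightarrow> complex \<times> complex \<times> complex \<Rightarrow> bool" where
  "bulk_mode C s2 s3 z \<kappa> F \<longleftrightarrow> F \<noteq> (0, 0, 0) \<and>
    (let G = relax (of_real C) (of_real s2) (of_real s3) F in
       z * f1 F = f1 G \<and> z * \<kappa> * f2 F = f2 G \<and> z * f3 F = \<kappa> * f3 G)"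

definition limit_of_stable_root :: "real \<Rightarrow> real \<Rightarrow> real \<Rightarrow> complex \<Rightarrow> complex \<Rightarrow> bool" where
  "limit_of_stable_root C s2 s3 z \<kappa> \<longleftrightarrow>
    (\<exists>zs ks. (\<forall>k. cmod (zs k) > 1 \<and> cmod (ks k) < 1 \<and> (\<exists>F. bulk_mode C s2 s3 (zs k) (ks k) F))
       \<and> zs \<longlonglongrightarrow> z \<and> ks \<longlonglongrightarrow> \<kappa>)"

definition critical_mode :: "bc \<Rightarrow> real \<Rightarrow> real \<Rightarrow> real \<Rightarrow> complex \<Rightarrow> complex \<Rightarrow> bool" where
  "critical_mode b C s2 s3 z \<kappa> \<longleftrightarrow> cmod z = 1 \<and> limit_of_stable_root C s2 s3 z \<kappa> \<and>
    (\<exists>F. bulk_mode C s2 s3 z \<kappa> F \<and>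
       z * f2 F = ghost b (\<lambda>j. smul3 (\<kappa>^j) (relax (of_real C) (of_real s2) (of_real s3) F)))"

definition label_SS :: "bc \<Rightarrow> real \<Rightarrow> real \<Rightarrow> real \<Rightarrow> real \<Rightarrow> bool" where
  "label_SS b C s2 s3 lam \<longleftrightarrow> SS_estimate b C s2 s3 lam"

definition label_SSOO :: "bc \<Rightarrow> real \<Rightarrow> real \<Rightarrow> real \<Rightarrow> real \<Rightarrow> bool" where
  "label_SSOO b C s2 s3 lam \<longleftrightarrow> SSOO_estimate b C s2 s3 lam \<and> \<not> SS_estimate b C s2 s3 lam"

definition label_MU_L :: "bc \<Rightarrow> real \<Rightarrow> real \<Rightarrow> real \<Rightarrow> real \<Rightarrow> bool" where
  "label_MU_L b C s2 s3 lam \<longleftrightarrow> \<not> SS_estimate b C s2 s3 lam \<and> \<not> SSOO_estimate b C s2 s3 lam \<and>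
     (\<exists>z \<kappa>. critical_mode b C s2 s3 z \<kappa> \<and> cmod \<kappa> < 1)"

definition label_MU_E :: "bc \<Rightarrow> real \<Rightarrow> real \<Rightarrow> real \<Rightarrow> real \<Rightarrow> bool" where
  "label_MU_E b C s2 s3 lam \<longleftrightarrow> \<not> SS_estimate b C s2 s3 lam \<and> \<not> SSOO_estimate b C s2 s3 lam \<and>
     (\<exists>z \<kappa>. critical_mode b C s2 s3 z \<kappa> \<and> cmod \<kappa> = 1)"

definition s3_star :: "real \<Rightarrow> real" where
  "s3_star s = (if s = 3 - 2 * sqrt 2 then 1 else
     1 + (sqrt ((s^2 - 8 * s + 8)^2 + 4 * s^2 * (2 - s)^2) - 2 * s * (2 - s)) / (s^2 - 8 * s + 8))"

end

theory Submission
  imports Defs "HOL-Complex_Analysis.Complex_Analysis" "HOL-Real_Asymp.Real_Asymp"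
begin

text \<open>
  After a \<open>Z\<close>-transform in time with \<open>w = 1/z\<close>, the solution is \<open>c(w) \<kappa>(w)^j F(w)\<close>, where \<open>\<kappa>\<close> is
  the root of the dispersion relation in the unit disc and \<open>c = w g / KL\<close> with the
  Kreiss-Lopatinskii determinant \<open>KL\<close>. The condition \<open>s3 \<le> s3*\<close> excludes roots of modulus one for
  \<open>|w| < 1\<close>, which makes \<open>\<kappa>\<close> holomorphic on the disc with \<open>\<kappa>(0) = 0\<close>; the Schwarz lemma then gives
  \<open>|\<kappa>(w)| \<le> |w|\<close>, so that summation over \<open>j\<close> costs exactly the factor \<open>1/(1 - |w|^2)\<close> allowed in the
  estimate. By Parseval the SS estimate follows as soon as \<open>KL\<close> does not vanish on the compact closure
  of the graph of \<open>\<kappa>\<close>. In the unstable cases \<open>KL = O(1 - w)\<close> along a real sequence \<open>w \<rightarrow> 1\<close>, and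
  the constant source \<open>g = 1\<close> violates even the estimate for the first moment.
\<close>

section \<open>Von Neumann stability\<close>

text \<open>Three obstacles shape the proof. The stable root is only known inside the disc, without
  continuity up to the circle, and at w = 1 the dispersion relation has the root k = 1 as well as
  any solution of \<open>disp_a 1 * k = disp_b 1\<close>. Boundary values are therefore replaced by
  a compact set of pairs (w, k) which records that k has modulus at most 1 and its companion root
  modulus at least 1; these inequalities select the limit at w = 1, and it is there that the sign of
  C enters. Next, the leading coefficient \<open>w * disp_a w\<close> of the quadratic may vanish,
  so the object continued holomorphically is not a root but the leading coefficient times the
  companion root, which has no zero. Finally, the sources are arbitrary and their Z-transforms need
  not converge, so the transform identities are proved for formal power series. Analysis enters
  after truncation of g or, for the instabilities, through the convergence which the assumed
  estimate itself provides. The threshold on s3 becomes polynomial in h = 2/s2 - 1 and k = 2/s3 - 1,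
  namely h + k \<le> h k (2 h + k).\<close>

lemma no_right_half_plane_root_pos:
  fixes h k v S :: real and W :: complex
  assumes h: "h > 0" and k: "k > 0" and cond: "h + k \<le> h * k * (2 * h + k)"
    and v: "v > 0" and S: "S > 0" and W: "Re W > 0"
  shows "(W + k) * (1 - \<i> * v * W) * (W + h + \<i> * v * (h * W + 1)) + S * (h * W + 1) * (k * W + 1) \<noteq> 0"
proof
  assume eq: "(W + k) * (1 - \<i> * v * W) * (W + h + \<i> * v * (h * W + 1)) + S * (h * W + 1) * (k * W + 1) = 0"
  define x y where "x = Re W" and "y = Im W"
  have x: "x > 0" using W by (simp add: x_def)
  have Weq: "W = Complex x y" by (simp add: x_def y_def)
  define n where "n = x^2 + y^2"
  define rh where "rh = h * n + h + x * (1 + h^2)"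
  define rk where "rk = k * n + k + x * (1 + k^2)"
  define Dh where "Dh = h^2 * n + 2 * h * x + 1"
  define Dk where "Dk = k^2 * n + 2 * k * x + 1"
  define J where "J = rh * (1 - k^2) + rk * (1 - h^2)"
  define P where "P = rh * rk - (y * (1 - h^2) + v * Dh) * (y * (1 - k^2))"
  define Q where "Q = y * J + v * Dh * rk"
  have n: "n > 0" using x by (simp add: n_def sum_power2_gt_zero_iff)
  have pos: "rh > 0" "rk > 0" "Dh > 0" "Dk > 0"
    using h k x n by (auto simp: rh_def rk_def Dh_def Dk_def intro!: add_pos_pos mult_pos_pos)
  have rhW: "(W + h) * (h * cnj W + 1) = Complex rh (y * (1 - h^2))"
    by (simp add: Weq complex_eq_iff rh_def n_def algebra_simps power2_eq_square)
  have rkW: "(W + k) * (k * cnj W + 1) = Complex rk (y * (1 - k^2))"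
    by (simp add: Weq complex_eq_iff rk_def n_def algebra_simps power2_eq_square)
  have DhW: "(h * W + 1) * (h * cnj W + 1) = Dh"
    by (simp add: Weq complex_eq_iff Dh_def n_def algebra_simps power2_eq_square)
  have DkW: "(k * W + 1) * (k * cnj W + 1) = Dk"
    by (simp add: Weq complex_eq_iff Dk_def n_def algebra_simps power2_eq_square)
  \<comment> \<open>The conjugate factors turn the S-term into the positive real number
    \<open>S * Dh * Dk\<close>; the other product must then be a negative real number.\<close>
  have "0 = ((W + k) * (1 - \<i> * v * W) * (W + h + \<i> * v * (h * W + 1)) + S * (h * W + 1) * (k * W + 1))
      * ((h * cnj W + 1) * (k * cnj W + 1))"
    using eq by simp
  also have "\<dots> = (1 - \<i> * v * W) * ((W + h) * (h * cnj W + 1) + \<i> * v * ((h * W + 1) * (h * cnj W + 1)))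
      * ((W + k) * (k * cnj W + 1)) + S * ((h * W + 1) * (h * cnj W + 1)) * ((k * W + 1) * (k * cnj W + 1))"
    by (simp add: algebra_simps)
  also have "\<dots> = Complex (1 + v * y) (- v * x) * Complex P Q + S * Dh * Dk"
    unfolding rhW rkW DhW DkW
    by (simp add: Weq complex_eq_iff P_def Q_def J_def algebra_simps)
  finally have eq2: "Complex (1 + v * y) (- v * x) * Complex P Q + S * Dh * Dk = 0" by simp
  have re: "(1 + v * y) * P + v * x * Q + S * Dh * Dk = 0"
    using arg_cong[OF eq2, of Re] by (simp add: algebra_simps)
  have im: "(1 + v * y) * Q - v * x * P = 0"
    using arg_cong[OF eq2, of Im] by (simp add: algebra_simps)
  \<comment> \<open>Eliminating P: since (1 + v y - i v x)(P + i Q) is real and negative, Q has the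
    sign of - v x.\<close>
  have "Q * ((1 + v * y)^2 + (v * x)^2) = - (S * Dh * Dk * v * x)"
    using re im by algebra
  moreover have "S * Dh * Dk * v * x > 0" using S v x pos by simp
  ultimately have Q: "Q < 0"
    by (smt (verit) mult_nonneg_nonneg sum_power2_ge_zero)
  define r where "r = - (v * y)"
  define A where "A = Dh * (rk + x * (1 - k^2))"
  define B where "B = y^2 * J + Dh * rk - x * (rh * rk - y^2 * (1 - h^2) * (1 - k^2))"
  \<comment> \<open>Eliminating \<open>S\<close> leaves the vanishing imaginary part, a quadratic equation for \<open>r = - v Im W\<close>,
    while \<open>S > 0\<close> restricts \<open>r\<close> to lie between \<open>0\<close> and \<open>y^2 * J / (Dh * rk)\<close>.\<close>
  have quad: "A * r^2 - B * r + y^2 * J = 0"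
  proof -
    have "A * r^2 - B * r + y^2 * J = y * ((1 + v * y) * Q - v * x * P)"
      by (simp add: A_def B_def r_def Q_def P_def J_def algebra_simps power2_eq_square)
    then show ?thesis using im by simp
  qed
  have A: "A > 0"
  proof -
    have "rk + x * (1 - k^2) = k * n + k + 2 * x" by (simp add: rk_def algebra_simps)
    then show ?thesis using pos x k n by (simp add: A_def add_pos_pos)
  qed
  have "v * Dh * rk > 0" using v pos by simp
  then have yJ: "y * J < 0" using Q by (simp add: Q_def)
  have y2J: "y^2 * J - r * Dh * rk = y * Q" by (simp add: r_def Q_def algebra_simps power2_eq_square)
  show False
  proof (cases "y > 0")
    case True
    then have J: "J < 0" using yJ by (simp add: mult_less_0_iff)
    have r: "r < 0" using True v by (simp add: r_def)
    define r0 where "r0 = y^2 * J / (Dh * rk)"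
    have r0eq: "r0 * (Dh * rk) = y^2 * J" using pos by (simp add: r0_def)
    have r0: "r0 < r"
    proof -
      have "y^2 * J < r * (Dh * rk)" using y2J Q True by (smt (verit) mult.assoc mult_pos_neg)
      then show ?thesis using pos by (simp add: r0_def divide_less_eq)
    qed
    have fr0: "rk * (A * r0^2 - B * r0 + y^2 * J) = r0 * x * rh * (rk^2 + y^2 * (1 - k^2)^2)"
    proof -
      have "rk * (A * r0^2 - B * r0 + y^2 * J)
        = r0 * ((r0 * (Dh * rk)) * (rk + x * (1 - k^2)) - B * rk) + rk * (y^2 * J)"
        by (simp add: A_def algebra_simps power2_eq_square)
      also have "\<dots> = r0 * (y^2 * J * (rk + x * (1 - k^2)) - B * rk + rk * (Dh * rk))"
        unfolding r0eq[symmetric] by (simp add: algebra_simps)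
      also have "\<dots> = r0 * x * rh * (rk^2 + y^2 * (1 - k^2)^2)"
        unfolding B_def J_def by (simp add: algebra_simps power2_eq_square)
      finally show ?thesis .
    qed
    have "r0 * x * rh * (rk^2 + y^2 * (1 - k^2)^2) < 0"
      using r0 r x pos by (intro mult_neg_pos mult_pos_pos add_pos_nonneg) auto
    then have fneg: "A * r0^2 - B * r0 + y^2 * J < 0"
      using fr0 pos by (metis mult_less_0_iff order_less_asym')
    have f0: "y^2 * J < 0" using J True by (simp add: mult_pos_neg)
    \<comment> \<open>Convexity as an identity: as A > 0, a quadratic that is negative at r0 and at
      0 is negative in between. Both sides carry the factor r0 < 0.\<close>
    have "r0 * (A * r^2 - B * r + y^2 * J)
      = r * (A * r0^2 - B * r0 + y^2 * J) + (r0 - r) * (y^2 * J) + A * r * r0 * (r - r0)"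
      by (simp add: algebra_simps power2_eq_square)
    moreover have "r * (A * r0^2 - B * r0 + y^2 * J) > 0" using r fneg by (rule mult_neg_neg)
    moreover have "(r0 - r) * (y^2 * J) > 0" using r0 f0 by (intro mult_neg_neg) auto
    moreover have "A * r * r0 * (r - r0) > 0"
      using A r r0 by (simp add: mult_neg_neg mult_pos_neg zero_less_mult_iff)
    ultimately show False using quad by simp
  next
    case False
    moreover have "y \<noteq> 0" using yJ by auto
    ultimately have y: "y < 0" by simp
    have J: "J > 0" using yJ y by (simp add: mult_less_0_iff)
    have r: "r > 0" using y v by (simp add: r_def mult_pos_neg)
    have lt: "r * (Dh * rk) < y^2 * J"
      using y2J mult_neg_neg[OF y Q] by (simp add: algebra_simps)
    have c0: "h * (1 - k^2) \<le> k * (2 * h^2 - 1)" 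
      using cond by (simp add: algebra_simps power2_eq_square)
    define p where "p = h * k"
    have p: "p > 0" using h k by (simp add: p_def)
    have p1: "h * (2 * p - 1) \<ge> k * (1 - p)" 
      using cond by (simp add: p_def algebra_simps)
    have p2: "p > 1/2"
    proof (rule ccontr)
      assume "\<not> p > 1/2"
      then have "h * (2 * p - 1) \<le> 0" "k * (1 - p) > 0" using h k by (auto intro: mult_nonneg_nonpos)
      then show False using p1 by linarith
    qed
    \<comment> \<open>This controls the coefficient of \<open>x * y^2\<close> in the decomposition
      of \<open>Dh * rk - y^2 * J\<close> further down.\<close>
    have key: "h^2 * (1 + 3 * k^2) + 2 * h * k \<ge> 2"
    proof -
      have "h^2 + 3 * p^2 + 2 * p \<ge> 2"
      proof (cases "p \<ge> 1")
        case True
        then have "p^2 \<ge> 1" by simp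
        then show ?thesis using True by (smt (verit) zero_le_power2)
      next
        case False
        have "h * (h * (2 * p - 1)) \<ge> h * (k * (1 - p))" using p1 h by (intro mult_left_mono) auto
        then have a: "h^2 * (2 * p - 1) \<ge> p * (1 - p)" by (simp add: p_def power2_eq_square algebra_simps)
        \<comment> \<open>The cubic is what remains of the claim after h^2 is bounded below by p (1
          - p) / (2 p - 1). It nearly touches 0 around p = 1/2, hence the expansion about that
          point.\<close>
        have "6 * p^3 - 5 * p + 2 \<ge> 0"
        proof -
          have "6 * p^3 - 5 * p + 2 = 6 * (p + 1) * (p - 1/2)^2 + (1/2) * (1 - p)"
            by (simp add: field_simps power2_eq_square power3_eq_cube)
          then show ?thesis using p False by simp
        qed
        then have "p * (1 - p) \<ge> (2 - 2 * p - 3 * p^2) * (2 * p - 1)"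
          by (simp add: algebra_simps power2_eq_square power3_eq_cube)
        then have "(2 - 2 * p - 3 * p^2) * (2 * p - 1) \<le> h^2 * (2 * p - 1)" using a by linarith
        then have "2 - 2 * p - 3 * p^2 \<le> h^2" using p2 by (simp add: mult_le_cancel_right)
        then show ?thesis by simp
      qed
      then show ?thesis by (simp add: p_def algebra_simps power2_eq_square)
    qed
    have le: "y^2 * J \<le> Dh * rk"
    proof -
      \<comment> \<open>The first coefficient is nonnegative exactly by \<open>cond\<close>. For x
        tending to 0 and large |y| this term dominates, so this is where the stability threshold is
        felt.\<close>
      have "Dh * rk - y^2 * J = y^2 * (n + 1) * (k * (2 * h^2 - 1) - h * (1 - k^2))
          + x * y^2 * (h^2 * (1 + 3 * k^2) + 2 * h * k - 2)
          + ((h * x)^2 + 1) * rk + 2 * h * x * (k * (x^2 + 1) + x * (1 + k^2))"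
        by (simp add: Dh_def rk_def rh_def J_def n_def algebra_simps power2_eq_square)
      moreover have "y^2 * (n + 1) * (k * (2 * h^2 - 1) - h * (1 - k^2)) \<ge> 0"
        using c0 n by simp
      moreover have "x * y^2 * (h^2 * (1 + 3 * k^2) + 2 * h * k - 2) \<ge> 0"
        using key x by simp
      moreover have "((h * x)^2 + 1) * rk \<ge> 0" "2 * h * x * (k * (x^2 + 1) + x * (1 + k^2)) \<ge> 0"
        using pos h k x by auto
      ultimately show ?thesis by linarith
    qed
    have r1: "r < 1" using lt le pos
      by (metis less_le_trans mult.left_neutral mult_less_cancel_right_pos mult_pos_pos)
    \<comment> \<open>The quadratic splits into (1 - r)(y^2 J - r Dh rk) plus x r times this
      bracket, so positivity of the bracket contradicts \<open>quad\<close>.\<close>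
    have br: "r * Dh * (1 - k^2) + rh * rk - y^2 * (1 - h^2) * (1 - k^2) > 0"
    proof (cases "k \<le> 1")
      case True
      then have k2: "0 \<le> 1 - k^2" using k by (simp add: power_le_one)
      have "rh * rk > y^2 * (1 - h^2) * (1 - k^2)"
      proof (cases "h \<le> 1")
        case False
        then have "1 - h^2 \<le> 0" by simp
        then have "y^2 * (1 - h^2) * (1 - k^2) \<le> 0"
          using k2 by (intro mult_nonpos_nonneg mult_nonneg_nonpos) auto
        then show ?thesis using mult_pos_pos[OF pos(1,2)] by linarith
      next
        case True
        then have h2: "0 \<le> 1 - h^2" "1 - h^2 \<le> 1" using h by (simp_all add: power_le_one)
        have "rh \<ge> h * (n + 1)" "rk \<ge> k * (n + 1)" using x by (simp_all add: rh_def rk_def algebra_simps)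
        then have "rh * rk \<ge> (h * (n + 1)) * (k * (n + 1))"
          using h k n pos by (intro mult_mono) auto
        also have "(h * (n + 1)) * (k * (n + 1)) = p * (n + 1)^2" by (simp add: p_def power2_eq_square)
        finally have "rh * rk \<ge> p * (n + 1)^2" .
        moreover have "(n + 1)^2 \<ge> 4 * n" using zero_le_power2[of "n - 1"] 
          by (simp add: power2_eq_square algebra_simps)
        then have "p * (n + 1)^2 \<ge> 1/2 * (4 * n)" using p2 n by (intro mult_mono) auto
        moreover have "y^2 * ((1 - h^2) * (1 - k^2)) \<le> y^2 * 1"
          using h2 k2 by (intro mult_left_mono mult_le_one) auto
        moreover have "y^2 \<le> n" by (simp add: n_def)
        ultimately show ?thesis using n by (simp only: mult.assoc)
      qed
      moreover have "r * Dh * (1 - k^2) \<ge> 0" using r pos k2 by simp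
      ultimately show ?thesis by linarith
    next
      case False
      then have k2: "1 - k^2 < 0" using k by simp
      have "rk * (r * Dh * (1 - k^2) + rh * rk - y^2 * (1 - h^2) * (1 - k^2))
         = (1 - k^2) * (r * (Dh * rk) - y^2 * J) + (rh * rk^2 + y^2 * rh * (1-k^2)^2)"
        by (simp add: J_def algebra_simps power2_eq_square)
      moreover have "(1 - k^2) * (r * (Dh * rk) - y^2 * J) > 0" using k2 lt by (simp add: mult_neg_neg)
      moreover have "rh * rk^2 + y^2 * rh * (1-k^2)^2 > 0" using pos by (simp add: add_pos_nonneg)
      ultimately have "rk * (r * Dh * (1 - k^2) + rh * rk - y^2 * (1 - h^2) * (1 - k^2)) > 0"
        by linarith
      then show ?thesis using pos by (simp add: zero_less_mult_iff)
    qed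
    have "A * r^2 - B * r + y^2 * J = (1 - r) * (y^2 * J - r * (Dh * rk))
      + x * r * (r * Dh * (1 - k^2) + rh * rk - y^2 * (1 - h^2) * (1 - k^2))"
      by (simp add: A_def B_def algebra_simps power2_eq_square)
    moreover have "(1 - r) * (y^2 * J - r * (Dh * rk)) > 0" using r1 lt by simp
    moreover have "x * r * (r * Dh * (1 - k^2) + rh * rk - y^2 * (1 - h^2) * (1 - k^2)) > 0"
      using br x r by simp
    ultimately show False using quad by linarith
  qed
qed

text \<open>The degenerate case S = 0 makes the polynomial a product of three factors without zeros
  in the half-plane; negative v reduces to positive v because conjugation exchanges (W, v) with (cnj
  W, -v).\<close>

lemma no_right_half_plane_root:
  fixes h k v S :: real and W :: complex
  assumes h: "h > 0" and k: "k > 0" and cond: "h + k \<le> h * k * (2 * h + k)"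
    and S: "S \<ge> 0" "v = 0 \<Longrightarrow> S = 0" and W: "Re W > 0"
  shows "(W + k) * (1 - \<i> * v * W) * (W + h + \<i> * v * (h * W + 1)) + S * (h * W + 1) * (k * W + 1) \<noteq> 0"
proof (cases "S = 0")
  case True
  have "W + k \<noteq> 0" using W k by (auto simp: complex_eq_iff)
  moreover have "1 - \<i> * v * W \<noteq> 0" using W by (auto simp: complex_eq_iff)
  moreover have "W + h + \<i> * v * (h * W + 1) \<noteq> 0"
  proof
    assume eq: "W + h + \<i> * v * (h * W + 1) = 0"
    have re: "Re W + h - v * (h * Im W) = 0" using arg_cong[OF eq, of Re] by simp
    have im: "Im W = - v * (h * Re W + 1)" using arg_cong[OF eq, of Im] by (simp add: algebra_simps)
    have "Re W + h + h * v^2 * (h * Re W + 1) = 0"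
      using re unfolding im by (simp add: algebra_simps power2_eq_square)
    moreover have "h * v^2 * (h * Re W + 1) \<ge> 0" using h W by simp
    ultimately show False using h W by linarith
  qed
  ultimately show ?thesis using True by simp
next
  case False
  then have S0: "S > 0" and v0: "v \<noteq> 0" using S by auto
  show ?thesis
  proof (cases "v > 0")
    case True
    then show ?thesis using no_right_half_plane_root_pos[OF h k cond _ S0 W] by blast
  next
    case False
    then have v: "- v > 0" using v0 by simp
    have "Re (cnj W) > 0" using W by simp
    from no_right_half_plane_root_pos[OF h k cond v S0 this]
    have "cnj ((W + k) * (1 - \<i> * v * W) * (W + h + \<i> * v * (h * W + 1)) + S * (h * W + 1) * (k * W + 1)) \<noteq> 0"
      by simp
    then show ?thesis by (metis complex_cnj_zero)
  qed
qed

text \<open>At the root \<open>4 - 2 sqrt 2\<close> of the denominator, \<open>s3_star\<close> is \<open>1\<close> because \<open>x / 0 = 0\<close>; the exceptional value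
  \<open>3 - 2 sqrt 2\<close> in its definition only lowers the threshold.\<close>
lemma s3_star_imp:
  fixes s2 s3 :: real
  assumes "0 < s2" "s2 < 2" "0 < s3" "s3 < 2" "s3 \<le> s3_star s2"
  defines "h \<equiv> (2 - s2) / s2" and "k \<equiv> (2 - s3) / s3"
  shows "h + k \<le> h * k * (2 * h + k)"
proof -
  define D where "D = s2^2 - 8 * s2 + 8"
  define N where "N = 2 * s2 * (2 - s2)"
  define R where "R = sqrt (D^2 + N^2)"
  define m where "m = s3 - 1"
  have N: "N > 0" using assms by (simp add: N_def)
  have m: "-1 < m" "m < 1" using assms by (auto simp: m_def)
  have R2: "R^2 = D^2 + N^2" by (simp add: R_def)
  have R: "R \<ge> 0" by (simp add: R_def)
  have star: "s3_star s2 = (if s2 = 3 - 2 * sqrt 2 then 1 else 1 + (R - N) / D)"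
    unfolding s3_star_def R_def D_def N_def power_mult_distrib by simp
  \<comment> \<open>The roots of this quadratic in m = s3 - 1 are (-N + R)/D and (-N - R)/D, and the
    first is the general formula for \<open>s3_star s2 - 1\<close>.\<close>
  have poly: "D * m^2 + 2 * N * m - D \<le> 0"
  proof -
    consider "D = 0" | "s2 = 3 - 2 * sqrt 2" | "D > 0" "s2 \<noteq> 3 - 2 * sqrt 2" | "D < 0" "s2 \<noteq> 3 - 2 * sqrt 2"
      by linarith
    then show ?thesis
    proof cases
      case 1
      then have "m \<le> 0" using assms(5) star by (auto simp: m_def split: if_splits)
      then show ?thesis using 1 N by (simp add: mult_nonneg_nonpos)
    next
      case 2
      then have "m \<le> 0" using assms(5) star by (auto simp: m_def)
      have "D = 1 + 4 * sqrt 2" unfolding D_def 2 by (simp add: power2_eq_square algebra_simps)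
      then have D: "D > 0" by (simp add: add_pos_pos)
      have "m^2 \<le> 1" using m by (simp add: abs_square_le_1)
      then have "D * (m^2 - 1) \<le> 0" using D by (simp add: mult_nonneg_nonpos)
      moreover have "2 * N * m \<le> 0" using N \<open>m \<le> 0\<close> by (simp add: mult_nonneg_nonpos)
      ultimately show ?thesis by (simp add: algebra_simps)
    next
      case 3
      have "m \<le> (R - N) / D" using assms(5) star 3 by (simp add: m_def)
      then have le: "D * m + N \<le> R" using 3 by (simp add: field_simps)
      \<comment> \<open>For D > 0 the other root (-N - R)/D lies at or below -1, and m > -1.\<close>
      have "- (D * m + N) \<le> R"
      proof -
        have "- (D * m + N) \<le> D - N" using m 3 mult_left_mono[of "-1" m D] by simp
        also have "\<dots> \<le> R"
        proof (rule power2_le_imp_le[OF _ R])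
          show "(D - N)^2 \<le> R^2" unfolding R2 using 3 N by (simp add: power2_diff)
        qed
        finally show ?thesis .
      qed
      then have "(D * m + N)^2 \<le> R^2" using le R by (simp add: abs_le_square_iff[symmetric])
      then have "D * (D * m^2 + 2 * N * m - D) \<le> 0"
        unfolding R2 by (simp add: power2_eq_square algebra_simps)
      then show ?thesis using 3 by (simp add: mult_le_0_iff)
    next
      case 4
      \<comment> \<open>For D < 0 the parabola opens downwards and (R - N)/D is its smaller root, so
        being to the left of it gives the right sign.\<close>
      have "m \<le> (R - N) / D" using assms(5) star 4 by (simp add: m_def)
      then have le: "D * m + N \<ge> R" using 4 by (simp add: field_simps)
      then have "(D * m + N)^2 \<ge> R^2" using R by (intro power_mono) auto
      then have "D * (D * m^2 + 2 * N * m - D) \<ge> 0"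
        unfolding R2 by (simp add: power2_eq_square algebra_simps)
      then show ?thesis using 4 by (simp add: zero_le_mult_iff)
    qed
  qed
  have hk: "h > 0" "k > 0" using assms by (auto simp: h_def k_def)
  have s: "s2 = 2 / (1 + h)" "s3 = 2 / (1 + k)" using assms(1,3) by (auto simp: h_def k_def field_simps)
  \<comment> \<open>With s2 = 2/(1 + h) both coefficients become polynomial in h, and m = (1 - k)/(1
    + k) turns \<open>poly\<close> into the claim.\<close>
  have D: "D * (1 + h)^2 = 4 * (2 * h^2 - 1)" and N: "N * (1 + h)^2 = 8 * h" 
  proof -
    have "s2 * (1 + h) = 2" using assms(1) by (simp add: h_def field_simps)
    note s2h = this
    have "D * (1 + h)^2 = (s2 * (1 + h))^2 - 8 * (s2 * (1 + h)) * (1 + h) + 8 * (1 + h)^2"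
      by (simp add: D_def algebra_simps power2_eq_square)
    also have "\<dots> = 4 * (2 * h^2 - 1)" unfolding s2h by (simp add: algebra_simps power2_eq_square)
    finally show "D * (1 + h)^2 = 4 * (2 * h^2 - 1)" .
    have "N * (1 + h)^2 = 2 * (s2 * (1 + h)) * (2 * (1 + h) - s2 * (1 + h))"
      by (simp add: N_def algebra_simps power2_eq_square)
    also have "\<dots> = 8 * h" unfolding s2h by (simp add: algebra_simps)
    finally show "N * (1 + h)^2 = 8 * h" .
  qed
  have m: "m * (1 + k) = 1 - k" using hk unfolding m_def s by (auto simp: field_simps)
  have "(D * m^2 + 2 * N * m - D) * ((1 + h)^2 * (1 + k)^2)
      = D * (1 + h)^2 * (m * (1 + k))^2 + 2 * (N * (1 + h)^2) * (m * (1 + k)) * (1 + k) - D * (1 + h)^2 * (1 + k)^2"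
    by (simp add: algebra_simps power2_eq_square)
  also have "\<dots> = 16 * (h * (1 - k^2) - k * (2 * h^2 - 1))"
    unfolding D N m by (simp add: algebra_simps power2_eq_square)
  finally have "16 * (h * (1 - k^2) - k * (2 * h^2 - 1)) \<le> 0"
    using poly by (metis mult_nonpos_nonneg mult_nonneg_nonneg zero_le_power2)
  then show ?thesis by (simp add: algebra_simps power2_eq_square)
qed

section \<open>The holomorphic stable root\<close>

text \<open>For the quadratic w \<alpha> k^2 - 2 p k + w \<beta> = 0, P is w \<alpha> times one
  root, while w \<beta> / P is the other; the two inequalities say that these roots lie outside and
  inside the unit circle, and they make sense even where w \<alpha> = 0. They hold at w = 0 and can
  only fail by passing through equality, which \<open>circ\<close> forbids, so connectedness of the
  ball propagates them. \<open>disc\<close> supplies the holomorphic square root.\<close>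

lemma stable_root_on_ball:
  fixes p \<alpha> \<beta> :: "complex \<Rightarrow> complex"
  assumes R: "R > 0"
    and hol: "p holomorphic_on ball 0 R" "\<alpha> holomorphic_on ball 0 R" "\<beta> holomorphic_on ball 0 R"
    and p0: "p 0 \<noteq> 0"
    and ab: "\<And>w. norm w < R \<Longrightarrow> \<alpha> w \<noteq> \<beta> w"
    and circ: "\<And>w k. norm w < R \<Longrightarrow> norm k = 1 \<Longrightarrow> k * (2 * p w - w * \<alpha> w * k) \<noteq> w * \<beta> w"
    and disc: "\<And>w. norm w < R \<Longrightarrow> (p w)^2 - w^2 * \<alpha> w * \<beta> w \<noteq> 0"
  shows "\<exists>P. P holomorphic_on ball 0 R \<and> (\<forall>w\<in>ball 0 R. (P w)^2 - 2 * p w * P w + w^2 * \<alpha> w * \<beta> w = 0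
    \<and> norm (w * \<alpha> w) < norm (P w) \<and> norm (w * \<beta> w) < norm (P w))"
proof -
  let ?B = "ball (0::complex) R"
  have "\<exists>g. g holomorphic_on ?B \<and> (\<forall>w\<in>?B. (p w)^2 - w^2 * \<alpha> w * \<beta> w = (g w)^2)"
  proof -
    have "(\<lambda>w. (p w)^2 - w^2 * \<alpha> w * \<beta> w) holomorphic_on ?B" by (intro holomorphic_intros hol)
    moreover have "\<forall>w\<in>?B. (p w)^2 - w^2 * \<alpha> w * \<beta> w \<noteq> 0" using disc by simp
    moreover have "simply_connected ?B" by (intro convex_imp_simply_connected convex_ball)
    ultimately show ?thesis
      using simply_connected_eq_holomorphic_sqrt[OF open_ball, of 0 R] by blast
  qed
  then obtain g where g: "g holomorphic_on ?B" "\<And>w. w \<in> ?B \<Longrightarrow> (p w)^2 - w^2 * \<alpha> w * \<beta> w = (g w)^2"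
    by blast
  have "(g 0)^2 = (p 0)^2" using g(2)[of 0] R by simp
  \<comment> \<open>The sign selects the branch with P(0) = 2 p(0) rather than P(0) = 0.\<close>
  then obtain \<sigma> :: complex where \<sigma>: "\<sigma> = 1 \<or> \<sigma> = -1" "\<sigma> * g 0 = p 0"
    by (metis mult_1 mult_minus1 minus_minus power2_eq_iff)
  define P where "P = (\<lambda>w. p w + \<sigma> * g w)"
  have Ph: "P holomorphic_on ?B" unfolding P_def by (intro holomorphic_intros hol g)
  have Peq: "(P w)^2 - 2 * p w * P w + w^2 * \<alpha> w * \<beta> w = 0" if "w \<in> ?B" for w
  proof -
    have "(\<sigma> * g w)^2 = (p w)^2 - w^2 * \<alpha> w * \<beta> w" using g(2)[OF that] \<sigma>(1) by auto
    then show ?thesis unfolding P_def by (simp add: power2_eq_square algebra_simps)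
  qed
  have P0: "P 0 \<noteq> 0" using p0 \<sigma> by (simp add: P_def)
  have strict: "norm (w * \<alpha> w) < norm (P w) \<and> norm (w * \<beta> w) < norm (P w)"
    if w: "w \<in> ?B" and le: "norm (w * \<alpha> w) \<le> norm (P w)" "norm (w * \<beta> w) \<le> norm (P w)" for w
  proof -
    have nz: "P w \<noteq> 0"
    proof
      assume "P w = 0"
      then have "w * \<alpha> w = 0" "w * \<beta> w = 0" using le by auto
      then have "w = 0" using ab[of w] w by auto
      then show False using P0 \<open>P w = 0\<close> by simp
    qed
    have eq: "2 * p w * P w = (P w)^2 + w^2 * \<alpha> w * \<beta> w" 
      using Peq[OF w] by (simp add: algebra_simps)
    have 1: "norm (w * \<beta> w) \<noteq> norm (P w)"
    proof
      assume n: "norm (w * \<beta> w) = norm (P w)"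
      define k where "k = w * \<beta> w / P w"
      have "norm k = 1" using n nz by (simp add: k_def norm_divide)
      moreover have "k * (2 * p w - w * \<alpha> w * k) = w * \<beta> w"
      proof -
        have "k * (2 * p w - w * \<alpha> w * k) * (P w)^2 = w * \<beta> w * (2 * p w * P w - w^2 * \<alpha> w * \<beta> w)"
          using nz by (simp add: k_def field_simps power2_eq_square)
        also have "\<dots> = w * \<beta> w * (P w)^2" unfolding eq by simp
        finally show ?thesis using nz by simp
      qed
      ultimately show False using circ[of w k] w by auto
    qed
    have 2: "norm (w * \<alpha> w) \<noteq> norm (P w)"
    proof
      assume n: "norm (w * \<alpha> w) = norm (P w)"
      then have wa: "w * \<alpha> w \<noteq> 0" using nz by auto
      define k where "k = P w / (w * \<alpha> w)"
      have "norm k = 1" using n nz by (simp add: k_def norm_divide)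
      moreover have "k * (2 * p w - w * \<alpha> w * k) = w * \<beta> w"
      proof -
        have "w * \<alpha> w * k = P w" using wa by (simp add: k_def)
        then have "k * (2 * p w - w * \<alpha> w * k) * (w * \<alpha> w) = P w * (2 * p w - P w)" 
          by (metis mult.assoc mult.commute)
        also have "\<dots> = w * \<beta> w * (w * \<alpha> w)" using eq by (simp add: power2_eq_square algebra_simps)
        finally show ?thesis using wa by (metis mult_right_cancel)
      qed
      ultimately show False using circ[of w k] w by auto
    qed
    show ?thesis using 1 2 le by simp
  qed
  define f where "f = (\<lambda>w. norm (P w) - max (norm (w * \<alpha> w)) (norm (w * \<beta> w)))"
  have cont: "continuous_on ?B f" unfolding f_def
    by (intro continuous_intros holomorphic_on_imp_continuous_on hol Ph)
  have fpos: "f w > 0" if "w \<in> ?B" for w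
  proof (rule ccontr)
    assume neg: "\<not> f w > 0"
    have "connected (f ` ?B)" using cont by (intro connected_continuous_image) auto
    moreover have "f 0 > 0" "0 \<in> ?B" using P0 R by (auto simp: f_def)
    ultimately have "0 \<in> f ` ?B"
      using that neg connectedD_interval[of "f ` ?B" "f w" "f 0" 0] by auto
    then obtain u where u: "u \<in> ?B" "f u = 0" by auto
    then have "norm (u * \<alpha> u) \<le> norm (P u)" "norm (u * \<beta> u) \<le> norm (P u)" by (auto simp: f_def)
    then have "f u > 0" using strict[OF u(1)] by (simp add: f_def)
    then show False using u by simp
  qed
  show ?thesis
    using Ph Peq fpos by (intro exI[of _ P]) (auto simp: f_def)
qed

text \<open>At a zero u of least modulus the preceding construction is available on the open ball of
  radius |u|. Approaching u radially, P tends to p(u) and the strict inequalities survive as weak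
  ones; as p^2 = (u \<alpha>)(u \<beta>), they become equalities, so the double root at u has
  modulus 1, against \<open>circ\<close>.\<close>

lemma discriminant_nonzero:
  fixes p \<alpha> \<beta> :: "complex \<Rightarrow> complex"
  assumes hol: "p holomorphic_on ball 0 1" "\<alpha> holomorphic_on ball 0 1" "\<beta> holomorphic_on ball 0 1"
    and p0: "p 0 \<noteq> 0"
    and ab: "\<And>w. norm w < 1 \<Longrightarrow> \<alpha> w \<noteq> \<beta> w"
    and circ: "\<And>w k. norm w < 1 \<Longrightarrow> norm k = 1 \<Longrightarrow> k * (2 * p w - w * \<alpha> w * k) \<noteq> w * \<beta> w"
    and w: "norm w < 1"
  shows "(p w)^2 - w^2 * \<alpha> w * \<beta> w \<noteq> 0"
proof
  assume w0: "(p w)^2 - w^2 * \<alpha> w * \<beta> w = 0"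
  define D where "D = (\<lambda>w. (p w)^2 - w^2 * \<alpha> w * \<beta> w)"
  note hc = holomorphic_on_imp_continuous_on
  have contD: "continuous_on (ball 0 1) D" 
    unfolding D_def by (intro continuous_intros hc hol)
  define Z where "Z = {u \<in> cball 0 (norm w). D u = 0}"
  have "cball 0 (norm w) \<subseteq> ball (0::complex) 1" using w by auto
  then have "continuous_on (cball 0 (norm w)) D" using contD continuous_on_subset by blast
  then have "closed Z" unfolding Z_def by (intro continuous_closed_preimage_constant) auto
  moreover have "bounded Z" unfolding Z_def by (rule bounded_subset[OF bounded_cball[of 0 "norm w"]]) auto
  ultimately have "compact Z" by (simp add: compact_eq_bounded_closed)
  moreover have "w \<in> Z" using w0 by (simp add: Z_def D_def)
  then have "Z \<noteq> {}" by auto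
  ultimately obtain u where u: "u \<in> Z" "\<And>y. y \<in> Z \<Longrightarrow> norm u \<le> norm y"
    using continuous_attains_inf[of Z norm] continuous_on_norm_id by blast
  have u1: "norm u \<le> norm w" "D u = 0" using u by (auto simp: Z_def)
  then have ub: "u \<in> ball 0 1" using w by auto
  define R where "R = norm u"
  have "D 0 \<noteq> 0" using p0 by (simp add: D_def)
  then have "u \<noteq> 0" using u1 by auto
  then have R: "R > 0" by (simp add: R_def)
  have sub: "ball 0 R \<subseteq> ball (0::complex) 1" using ub by (auto simp: R_def)
  have nz: "(p y)^2 - y^2 * \<alpha> y * \<beta> y \<noteq> 0" if "norm y < R" for y
  proof
    assume "(p y)^2 - y^2 * \<alpha> y * \<beta> y = 0"
    then have "y \<in> Z" using that u1 by (auto simp: Z_def D_def R_def)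
    then show False using u(2)[of y] that by (simp add: R_def)
  qed
  have small: "norm y < 1" if "norm y < R" for y :: complex using that ub by (simp add: R_def)
  obtain P where P: "\<And>y. norm y < R \<Longrightarrow> (P y)^2 - 2 * p y * P y + y^2 * \<alpha> y * \<beta> y = 0"
    "\<And>y. norm y < R \<Longrightarrow> norm (y * \<alpha> y) < norm (P y)" "\<And>y. norm y < R \<Longrightarrow> norm (y * \<beta> y) < norm (P y)"
    using stable_root_on_ball[OF R holomorphic_on_subset[OF hol(1) sub] holomorphic_on_subset[OF hol(2) sub]
        holomorphic_on_subset[OF hol(3) sub] p0 ab[OF small] circ[OF small] nz] by fastforce
  define x where "x = (\<lambda>n. (1 - inverse (of_nat (Suc n))) * u)"
  have xn: "norm (x n) < R" for n
  proof -
    have "norm (1 - inverse (of_nat (Suc n)) :: complex) = 1 - inverse (real (Suc n))"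
    proof -
      have "(1 - inverse (of_nat (Suc n)) :: complex) = of_real (1 - inverse (real (Suc n)))" by simp
      then show ?thesis by (simp only: norm_of_real) (simp add: field_simps)
    qed
    then have "norm (x n) = (1 - inverse (real (Suc n))) * R" by (simp add: x_def norm_mult R_def)
    then show ?thesis using R by simp
  qed
  have "x \<longlonglongrightarrow> (1 - 0) * u"
    unfolding x_def by (intro tendsto_intros LIMSEQ_inverse_real_of_nat lim_inverse_n' filterlim_Suc)
      (use LIMSEQ_Suc[OF lim_inverse_n] in \<open>simp add: inverse_eq_divide\<close>)
  then have xlim: "x \<longlonglongrightarrow> u" by simp
  have cts: "isCont f u" if "f holomorphic_on ball 0 1" for f
    using holomorphic_on_imp_continuous_on[OF that] ub by (simp add: continuous_on_eq_continuous_at)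
  have lim: "(\<lambda>n. f (x n)) \<longlonglongrightarrow> f u" if "f holomorphic_on ball 0 1" for f
    using cts[OF that] xlim isCont_tendsto_compose by blast
  have "D holomorphic_on ball 0 1" unfolding D_def by (intro holomorphic_intros hol)
  then have "(\<lambda>n. D (x n)) \<longlonglongrightarrow> 0" using lim u1 by metis
  moreover have "D (x n) = (P (x n) - p (x n))^2" for n
    using P(1)[OF xn[of n]] by (simp add: D_def power2_eq_square algebra_simps)
  ultimately have "(\<lambda>n. sqrt (norm ((P (x n) - p (x n))^2))) \<longlonglongrightarrow> sqrt (norm (0::complex))"
    by (intro tendsto_intros) simp
  then have "(\<lambda>n. P (x n) - p (x n)) \<longlonglongrightarrow> 0"
    by (simp add: norm_power tendsto_norm_zero_iff)
  from tendsto_add[OF this lim[OF hol(1)]] have Plim: "(\<lambda>n. P (x n)) \<longlonglongrightarrow> p u" by simp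
  have le: "norm (u * \<alpha> u) \<le> norm (p u)" 
  proof (rule LIMSEQ_le)
    show "(\<lambda>n. norm (x n * \<alpha> (x n))) \<longlonglongrightarrow> norm (u * \<alpha> u)" by (intro tendsto_intros xlim lim hol)
    show "(\<lambda>n. norm (P (x n))) \<longlonglongrightarrow> norm (p u)" by (intro tendsto_intros Plim)
  qed (use P(2)[OF xn] in \<open>force intro: less_imp_le\<close>)
  have le': "norm (u * \<beta> u) \<le> norm (p u)"
  proof (rule LIMSEQ_le)
    show "(\<lambda>n. norm (x n * \<beta> (x n))) \<longlonglongrightarrow> norm (u * \<beta> u)" by (intro tendsto_intros xlim lim hol)
    show "(\<lambda>n. norm (P (x n))) \<longlonglongrightarrow> norm (p u)" by (intro tendsto_intros Plim)
  qed (use P(3)[OF xn] in \<open>force intro: less_imp_le\<close>)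
  have eq: "(p u)^2 = (u * \<alpha> u) * (u * \<beta> u)" using u1 by (simp add: D_def power2_eq_square algebra_simps)
  then have neq: "(norm (p u))^2 = norm (u * \<alpha> u) * norm (u * \<beta> u)" 
    by (metis norm_mult norm_power)
  have pnz: "p u \<noteq> 0"
  proof
    assume "p u = 0"
    then have "u * \<alpha> u = 0" "u * \<beta> u = 0" using le le' by auto
    then show False using \<open>u \<noteq> 0\<close> ab[of u] ub by auto
  qed
  have "norm (u * \<alpha> u) = norm (p u)"
  proof (rule ccontr)
    assume "norm (u * \<alpha> u) \<noteq> norm (p u)"
    then have "norm (u * \<alpha> u) < norm (p u)" using le by simp
    have "norm (u * \<alpha> u) * norm (u * \<beta> u) \<le> norm (u * \<alpha> u) * norm (p u)"
      using le' by (intro mult_left_mono) auto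
    also have "\<dots> < norm (p u) * norm (p u)"
      using \<open>norm (u * \<alpha> u) < norm (p u)\<close> pnz by (intro mult_strict_right_mono) auto
    finally have "norm (u * \<alpha> u) * norm (u * \<beta> u) < norm (p u) * norm (p u)" .
    then show False using neq by (simp add: power2_eq_square)
  qed
  then have ua: "u * \<alpha> u \<noteq> 0" and n: "norm (p u / (u * \<alpha> u)) = 1" 
    using pnz by (auto simp: norm_divide)
  have "p u / (u * \<alpha> u) * (2 * p u - u * \<alpha> u * (p u / (u * \<alpha> u))) = (p u)^2 / (u * \<alpha> u)"
    using ua by (simp add: power2_eq_square)
  also have "\<dots> = u * \<beta> u" using ua eq by simp
  finally show False using circ[OF _ n, of u] ub by (metis mem_ball_0)
qed

text \<open>\<kappa> is w \<beta> / P, which explains \<kappa>(0) = 0; the bracket 2 p - w \<alpha>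
  \<kappa> equals P, so the last conclusion keeps the information that the companion root is outside
  the closed disc.\<close>

lemma holomorphic_stable_root:
  fixes p \<alpha> \<beta> :: "complex \<Rightarrow> complex"
  assumes hol: "p holomorphic_on ball 0 1" "\<alpha> holomorphic_on ball 0 1" "\<beta> holomorphic_on ball 0 1"
    and p0: "p 0 \<noteq> 0"
    and ab: "\<And>w. norm w < 1 \<Longrightarrow> \<alpha> w \<noteq> \<beta> w"
    and circ: "\<And>w k. norm w < 1 \<Longrightarrow> norm k = 1 \<Longrightarrow> k * (2 * p w - w * \<alpha> w * k) \<noteq> w * \<beta> w"
  obtains \<kappa> where "\<kappa> holomorphic_on ball 0 1" "\<kappa> 0 = 0" "\<And>w. norm w < 1 \<Longrightarrow> norm (\<kappa> w) < 1"
    "\<And>w. norm w < 1 \<Longrightarrow> \<kappa> w * (2 * p w - w * \<alpha> w * \<kappa> w) = w * \<beta> w"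
    "\<And>w. norm w < 1 \<Longrightarrow> norm (w * \<alpha> w) < norm (2 * p w - w * \<alpha> w * \<kappa> w)"
proof -
  obtain P where P: "P holomorphic_on ball 0 1"
    "\<And>y. norm y < 1 \<Longrightarrow> (P y)^2 - 2 * p y * P y + y^2 * \<alpha> y * \<beta> y = 0"
    "\<And>y. norm y < 1 \<Longrightarrow> norm (y * \<alpha> y) < norm (P y)" "\<And>y. norm y < 1 \<Longrightarrow> norm (y * \<beta> y) < norm (P y)"
    using stable_root_on_ball[OF zero_less_one hol p0 ab circ discriminant_nonzero[OF hol p0 ab circ]]
    by fastforce
  have nz: "P w \<noteq> 0" if "norm w < 1" for w using P(3)[OF that] by auto
  define \<kappa> where "\<kappa> = (\<lambda>w. w * \<beta> w / P w)"
  have Peq: "2 * p w - w * \<alpha> w * \<kappa> w = P w" if w: "norm w < 1" for w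
  proof -
    have "(2 * p w - w * \<alpha> w * \<kappa> w) * P w = 2 * p w * P w - w^2 * \<alpha> w * \<beta> w"
      using nz[OF w] by (simp add: \<kappa>_def field_simps power2_eq_square)
    also have "\<dots> = P w * P w" using P(2)[OF w] by (simp add: power2_eq_square algebra_simps)
    finally show ?thesis using nz[OF w] by simp
  qed
  show thesis
  proof
    show "\<kappa> holomorphic_on ball 0 1" unfolding \<kappa>_def
      using nz by (intro holomorphic_intros hol P) auto
    show "\<kappa> 0 = 0" by (simp add: \<kappa>_def)
    show "norm (\<kappa> w) < 1" if "norm w < 1" for w
      using P(4)[OF that] nz[OF that] by (simp add: \<kappa>_def norm_divide)
    show "\<kappa> w * (2 * p w - w * \<alpha> w * \<kappa> w) = w * \<beta> w" if "norm w < 1" for w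
      unfolding Peq[OF that] using nz[OF that] by (simp add: \<kappa>_def)
    show "norm (w * \<alpha> w) < norm (2 * p w - w * \<alpha> w * \<kappa> w)" if "norm w < 1" for w
      unfolding Peq[OF that] using P(3)[OF that] .
  qed
qed

section \<open>Parseval on circles\<close>

lemma has_integral_cis_int:
  fixes k :: int
  shows "((\<lambda>t. cis (of_int k * t)) has_integral (if k = 0 then 2 * pi else 0)) {0..2*pi}"
proof (cases "k = 0")
  case True
  then show ?thesis using has_integral_const_real[of "1::complex" 0 "2*pi"] by (simp add: scaleR_conv_of_real)
next
  case False
  have "((\<lambda>t. cis (of_int k * t)) has_integral
     (cis (of_int k * (2*pi)) / (\<i> * of_int k) - cis (of_int k * 0) / (\<i> * of_int k))) {0..2*pi}"
  proof (rule fundamental_theorem_of_calculus)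
    fix t :: real
    have "((\<lambda>t. exp (\<i> * of_int k * of_real t) / (\<i> * of_int k)) has_vector_derivative exp (\<i> * of_int k * of_real t)) (at t within {0..2*pi})"
      using False by (auto intro!: derivative_eq_intros has_vector_derivative_real_field)
    then show "((\<lambda>t. cis (of_int k * t) / (\<i> * of_int k)) has_vector_derivative cis (of_int k * t)) (at t within {0..2*pi})"
      by (simp add: cis_conv_exp mult_ac)
  qed simp
  moreover have "cis (of_int k * (2*pi)) = 1" by (metis cis_multiple_2pi Ints_of_int mult.commute)
  ultimately show ?thesis using False by simp
qed

lemma has_integral_norm_square_trig_poly:
  fixes a :: "nat \<Rightarrow> complex"
  shows "((\<lambda>t. (cmod (\<Sum>n<N. a n * cis (real n * t)))^2) has_integral (2 * pi * (\<Sum>n<N. (cmod (a n))^2))) {0..2*pi}"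
proof -
  have eq: "complex_of_real ((cmod (\<Sum>n<N. a n * cis (real n * t)))^2)
      = (\<Sum>m<N. \<Sum>n<N. a m * cnj (a n) * cis (of_int (int m - int n) * t))" for t
    unfolding complex_norm_square
    unfolding cnj_sum sum_product
    by (intro sum.cong refl) (simp add: cis_cnj cis_mult algebra_simps)
  have "((\<lambda>t. \<Sum>m<N. \<Sum>n<N. a m * cnj (a n) * cis (of_int (int m - int n) * t)) has_integral
     (\<Sum>m<N. \<Sum>n<N. a m * cnj (a n) * (if int m - int n = 0 then 2 * pi else 0))) {0..2*pi}"
    by (intro has_integral_sum has_integral_mult_right has_integral_cis_int finite_lessThan)
  also have "(\<Sum>m<N. \<Sum>n<N. a m * cnj (a n) * (if int m - int n = 0 then 2 * pi else 0))
      = (\<Sum>m<N. \<Sum>n<N. if n = m then 2 * pi * (a m * cnj (a m)) else 0)"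
    by (intro sum.cong refl) auto
  also have "\<dots> = complex_of_real (2 * pi * (\<Sum>n<N. (cmod (a n))^2))"
    by (simp add: sum_distrib_left flip: complex_norm_square)
  finally have "((\<lambda>t. complex_of_real ((cmod (\<Sum>n<N. a n * cis (real n * t)))^2)) has_integral
      complex_of_real (2 * pi * (\<Sum>n<N. (cmod (a n))^2))) {0..2*pi}"
    unfolding eq .
  from has_integral_Re[OF this] show ?thesis by simp
qed

text \<open>The Taylor partial sums are trigonometric polynomials on the circle, uniformly bounded
  by the absolutely convergent series at radius r, so dominated convergence passes to the limit in
  the finite identity.\<close>

lemma parseval_circle:
  assumes f: "f holomorphic_on ball 0 1" and P: "f has_fps_expansion P" and r: "0 \<le> r" "r < 1"
  shows "((\<lambda>t. (cmod (f (of_real r * cis t)))^2) has_integral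
            (2 * pi * (\<Sum>n. (cmod (fps_nth P n))^2 * r^(2*n)))) {0..2*pi}"
    and "summable (\<lambda>n. (cmod (fps_nth P n))^2 * r^(2*n))"
proof -
  have sums: "(\<lambda>n. fps_nth P n * z^n) sums f z" if "norm z < 1" for z
    using has_fps_expansion_imp_sums_complex[OF P, of 1 z] f that by (simp add: one_ereal_def)
  define a where "a = (\<lambda>n. fps_nth P n * of_real r ^ n)"
  have "(1 + r)/2 < 1" "r < (1 + r)/2" using r by auto
  then have "summable (\<lambda>n. norm (fps_nth P n * of_real r ^ n))"
    using powser_insidea[OF sums_summable[OF sums[of "of_real ((1 + r)/2)"]], of "of_real r"] r
    by (simp only: norm_of_real)
  then have suma: "summable (\<lambda>n. norm (a n))" by (simp add: a_def)
  define B where "B = (\<Sum>n. norm (a n))"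
  define s where "s = (\<lambda>N t. \<Sum>n<N. a n * cis (real n * t))"
  have sB: "norm (s N t) \<le> B" for N t
  proof -
    have "norm (s N t) \<le> (\<Sum>n<N. norm (a n * cis (real n * t)))" unfolding s_def by (rule norm_sum)
    also have "\<dots> = (\<Sum>n<N. norm (a n))" by (simp add: norm_mult)
    also have "\<dots> \<le> B" unfolding B_def by (rule sum_le_suminf[OF suma]) auto
    finally show ?thesis .
  qed
  have slim: "(\<lambda>N. s N t) \<longlonglongrightarrow> f (of_real r * cis t)" for t
  proof -
    have "a n * cis (real n * t) = fps_nth P n * (of_real r * cis t)^n" for n
      unfolding a_def power_mult_distrib Complex.DeMoivre by (simp only: mult.assoc)
    then show ?thesis
      using sums[of "of_real r * cis t"] r by (simp add: norm_mult sums_def s_def)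
  qed
  define I where "I = (\<lambda>N. 2 * pi * (\<Sum>n<N. (cmod (a n))^2))"
  have int: "((\<lambda>t. (cmod (s N t))^2) has_integral I N) {0..2*pi}" for N
    unfolding s_def I_def by (rule has_integral_norm_square_trig_poly)
  have dom: "(\<lambda>t. (cmod (f (of_real r * cis t)))^2) integrable_on {0..2*pi}"
    "(\<lambda>N. integral {0..2*pi} (\<lambda>t. (cmod (s N t))^2)) \<longlonglongrightarrow> integral {0..2*pi} (\<lambda>t. (cmod (f (of_real r * cis t)))^2)"
  proof -
    have 1: "(\<lambda>t. (cmod (s N t))^2) integrable_on {0..2*pi}" for N using int by blast
    have 2: "(\<lambda>t. B^2) integrable_on {0..2*pi}" by (intro integrable_continuous_real continuous_on_const)
    have 3: "norm ((cmod (s N t))^2) \<le> B^2" for N t using sB[of N t] by (simp add: power_mono)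
    have 4: "(\<lambda>N. (cmod (s N t))^2) \<longlonglongrightarrow> (cmod (f (of_real r * cis t)))^2" for t
      by (intro tendsto_intros slim)
    show "(\<lambda>t. (cmod (f (of_real r * cis t)))^2) integrable_on {0..2*pi}"
      "(\<lambda>N. integral {0..2*pi} (\<lambda>t. (cmod (s N t))^2)) \<longlonglongrightarrow> integral {0..2*pi} (\<lambda>t. (cmod (f (of_real r * cis t)))^2)"
      using dominated_convergence[OF 1 2 3 4] by auto
  qed
  define L where "L = integral {0..2*pi} (\<lambda>t. (cmod (f (of_real r * cis t)))^2)"
  have "I \<longlonglongrightarrow> L" using dom(2) unfolding integral_unique[OF int] L_def .
  then have "(\<lambda>N. I N / (2 * pi)) \<longlonglongrightarrow> L / (2 * pi)" by (intro tendsto_intros) auto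
  then have "(\<lambda>n. (cmod (a n))^2) sums (L / (2 * pi))" by (simp add: sums_def I_def)
  moreover have "(cmod (a n))^2 = (cmod (fps_nth P n))^2 * r^(2*n)" for n
    using r by (simp add: a_def norm_mult norm_power power_mult_distrib power_mult mult.commute)
  ultimately have S: "(\<lambda>n. (cmod (fps_nth P n))^2 * r^(2*n)) sums (L / (2 * pi))" by simp
  then show "summable (\<lambda>n. (cmod (fps_nth P n))^2 * r^(2*n))" by (rule sums_summable)
  have "2 * pi * (\<Sum>n. (cmod (fps_nth P n))^2 * r^(2*n)) = L" unfolding sums_unique[OF S, symmetric] by simp
  then show "((\<lambda>t. (cmod (f (of_real r * cis t)))^2) has_integral
            (2 * pi * (\<Sum>n. (cmod (fps_nth P n))^2 * r^(2*n)))) {0..2*pi}"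
    using dom(1) by (simp add: L_def has_integral_integral)
qed

section \<open>Normal modes\<close>

locale d1q3 =
  fixes C s2 s3 :: real
  assumes C: "-1 < C" "C < 1" "C \<noteq> 0"
    and s2: "0 < s2" "s2 < 2" and s3: "0 < s3" "s3 < 2"
    and stable: "(2 - s2) / s2 + (2 - s3) / s3
      \<le> (2 - s2) / s2 * ((2 - s3) / s3) * (2 * ((2 - s2) / s2) + (2 - s3) / s3)"
begin

abbreviation relaxC :: "complex \<times> complex \<times> complex \<Rightarrow> complex \<times> complex \<times> complex" where
  "relaxC \<equiv> relax (of_real C) (of_real s2) (of_real s3)"

text \<open>\<open>(M1, M2, M3)\<close> are the moments of the mode with \<open>z = 1/w\<close> and \<open>\<kappa> = k\<close>, normalised so that
  \<open>M1\<close> and \<open>M3\<close> are polynomials, and \<open>M2s\<close>, \<open>M3s\<close> their values after relaxation. The formula for \<open>M2\<close> is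
  chosen such that its denominator does not vanish on the closed bidisc.\<close>

definition M1 :: "complex \<Rightarrow> complex" where "M1 w = 1 - of_real (1 - s3) * w"
definition M3 :: "complex \<Rightarrow> complex" where "M3 w = 1 - of_real (1 - s3 * C^2) * w"
definition M3s :: "complex \<Rightarrow> complex" where
  "M3s w = of_real (1 - s3 * (1 - C^2)) - of_real (1 - s3) * w"
definition M2 :: "complex \<Rightarrow> complex \<Rightarrow> complex" where
  "M2 w k = (M3 w + k * w * (of_real (s2 * C) * M1 w - M3s w)) / (1 - of_real (1 - s2) * k * w)"
definition M2s :: "complex \<Rightarrow> complex \<Rightarrow> complex" where
  "M2s w k = of_real (1 - s2) * M2 w k + of_real (s2 * C) * M1 w"
definition mode :: "complex \<Rightarrow> complex \<Rightarrow> complex \<times> complex \<times> complex" where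
  "mode w k = (M1 w - M3 w, (M3 w + M2 w k) / 2, (M3 w - M2 w k) / 2)"

definition disp_a :: "complex \<Rightarrow> complex" where
  "disp_a w = M3s w + of_real (1 - s2) * M3 w - of_real (s2 * C) * M1 w"
definition disp_b :: "complex \<Rightarrow> complex" where
  "disp_b w = M3s w + of_real (1 - s2) * M3 w + of_real (s2 * C) * M1 w"
definition disp_p :: "complex \<Rightarrow> complex" where
  "disp_p w = M3 w + of_real (1 - s2) * w^2 * M3s w"
text \<open>The equation for f2, multiplied by the denominator of \<open>M2\<close>. As a quadratic
  it reads w a k^2 - 2 p k + w b = 0; in the chosen form the bracket is w a times the companion root
  of k.\<close>

definition disp :: "complex \<Rightarrow> complex \<Rightarrow> bool" where
  "disp w k \<longleftrightarrow> k * (2 * disp_p w - w * disp_a w * k) = w * disp_b w"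

lemma moments_mode: "moments (mode w k) = (M1 w, M2 w k, M3 w)"
  by (simp add: moments_def mode_def f1_def f2_def f3_def field_simps)

lemma relax_mode:
  "relaxC (mode w k) = (M1 w - M3s w, (M3s w + M2s w k) / 2, (M3s w - M2s w k) / 2)"
proof -
  have "of_real (1 - s3) * M3 w + of_real s3 * (of_real C)^2 * M1 w = M3s w"
    by (simp add: M3_def M1_def M3s_def algebra_simps power2_eq_square)
  then show ?thesis
    unfolding relax_def moments_mode by (simp add: f1_def f2_def f3_def M2s_def Let_def)
qed

lemma norm_s2: "\<bar>1 - s2\<bar> < 1" and norm_s3: "\<bar>1 - s3\<bar> < 1" and C2: "0 < C^2" "C^2 < 1"
proof -
  show "\<bar>1 - s2\<bar> < 1" "\<bar>1 - s3\<bar> < 1" using s2 s3 by auto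
  show "0 < C^2" "C^2 < 1" using C by (auto simp: abs_square_less_1)
qed

lemma M2_denom_nz:
  fixes w k :: complex
  assumes "norm w \<le> 1" "norm k \<le> 1"
  shows "1 - of_real (1 - s2) * k * w \<noteq> 0"
proof
  assume "1 - of_real (1 - s2) * k * w = 0"
  then have "norm (of_real (1 - s2) * k * w) = 1" by (metis norm_one right_minus_eq)
  then have "\<bar>1 - s2\<bar> * (norm k * norm w) = 1" by (simp only: norm_mult norm_of_real mult.assoc)
  moreover have "norm k * norm w \<le> 1" using assms by (simp add: mult_le_one)
  then have "\<bar>1 - s2\<bar> * (norm k * norm w) \<le> \<bar>1 - s2\<bar>" by (simp add: mult_left_le)
  ultimately show False using norm_s2 by simp
qed

lemma M1_nz:
  assumes "norm w \<le> 1"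
  shows "M1 w \<noteq> 0"
proof
  assume "M1 w = 0"
  then have "norm (of_real (1 - s3) * w) = 1" unfolding M1_def by (metis norm_one right_minus_eq)
  then have "\<bar>1 - s3\<bar> * norm w = 1" by (simp only: norm_mult norm_of_real)
  moreover have "\<bar>1 - s3\<bar> * norm w \<le> \<bar>1 - s3\<bar>" using assms by (simp add: mult_left_le)
  ultimately show False using norm_s3 by simp
qed

lemma mode_1: "f1 (mode w k) = w * f1 (relaxC (mode w k))"
  unfolding relax_mode by (simp add: mode_def f1_def M1_def M3_def M3s_def algebra_simps)

lemma M2_eq:
  assumes "norm w \<le> 1" "norm k \<le> 1"
  shows "M2 w k = M3 w + k * w * (of_real (s2 * C) * M1 w - M3s w + of_real (1 - s2) * M2 w k)"
  using M2_denom_nz[OF assms] unfolding M2_def by (simp add: field_simps)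

lemma mode_3:
  assumes "norm w \<le> 1" "norm k \<le> 1"
  shows "f3 (mode w k) = k * w * f3 (relaxC (mode w k))"
proof -
  have "M3 w - M2 w k = k * w * (M3s w - M2s w k)"
    using M2_eq[OF assms] unfolding M2s_def by (simp add: algebra_simps)
  then show ?thesis unfolding relax_mode by (simp add: mode_def f3_def)
qed

text \<open>The only one of the three mode equations that uses the dispersion relation: the ratio of
  \<open>M1\<close> to \<open>M3\<close> was chosen to solve the first, and \<open>M2\<close> to
  solve the third.\<close>

lemma mode_2:
  assumes "norm w \<le> 1" "norm k \<le> 1" "disp w k"
  shows "k * f2 (mode w k) = w * f2 (relaxC (mode w k))"
proof -
  let ?d = "1 - of_real (1 - s2) * k * w"
  have d: "M2 w k * ?d = M3 w + k * w * (of_real (s2 * C) * M1 w - M3s w)"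
    using M2_denom_nz[OF assms(1,2)] by (simp add: M2_def)
  have "(k * (M3 w + M2 w k) - w * (M3s w + M2s w k)) * ?d
    = (k * M3 w - w * M3s w - w * of_real (s2 * C) * M1 w) * ?d + (k - w * of_real (1 - s2)) * (M2 w k * ?d)"
    unfolding M2s_def by (simp add: algebra_simps)
  also have "\<dots> = k * (2 * disp_p w - w * disp_a w * k) - w * disp_b w"
    unfolding d disp_p_def disp_a_def disp_b_def by (simp add: algebra_simps power2_eq_square)
  also have "\<dots> = 0" using assms(3) by (simp add: disp_def)
  finally have "k * (M3 w + M2 w k) = w * (M3s w + M2s w k)"
    using M2_denom_nz[OF assms(1,2)] by simp
  then show ?thesis unfolding relax_mode by (simp add: mode_def f2_def)
qed

lemma bulk_mode_mode:
  assumes "norm w \<le> 1" "norm k \<le> 1" "disp w k" "w \<noteq> 0"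
  shows "bulk_mode C s2 s3 (1 / w) k (mode w k)"
proof -
  have "mode w k \<noteq> (0, 0, 0)"
  proof
    assume "mode w k = (0, 0, 0)"
    then have "moments (mode w k) = (0, 0, 0)" by (simp add: moments_def f1_def f2_def f3_def)
    then show False using M1_nz[OF assms(1)] by (simp add: moments_mode)
  qed
  then show ?thesis
    unfolding bulk_mode_def Let_def
    using mode_1[of w k] mode_2[OF assms(1-3)] mode_3[OF assms(1,2)] assms(4)
    by (simp add: field_simps)
qed

text \<open>Both quantities are convex combinations with weights C^2 and 1 - C^2: \<open>M3\<close>
  of \<open>M1\<close> and 1 - w, and \<open>w * M3s\<close> of \<open>w * M1\<close> and (1 - s3) w
  (1 - w). The difference of the two points is s3 w in both cases, so the correction terms in the
  formula for the squared modulus of a convex combination cancel.\<close>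

lemma norm_M3_M3s:
  "(norm (M3 w))^2 - (norm (w * M3s w))^2
    = C^2 * (1 - (norm w)^2) * (norm (M1 w))^2
      + (1 - C^2) * (norm (1 - w))^2 * (1 - (1 - s3)^2 * (norm w)^2)"
  unfolding cmod_power2 M1_def M3_def M3s_def
  by (simp add: algebra_simps power2_eq_square)

lemma M3s_less_M3:
  assumes "norm w \<le> 1" "w \<noteq> 1"
  shows "norm (w * M3s w) < norm (M3 w)"
proof -
  have n: "(norm w)^2 \<le> 1" using assms by (simp add: power_le_one)
  have "C^2 * (1 - (norm w)^2) * (norm (M1 w))^2 \<ge> 0" using n by simp
  moreover have "(1 - s3)^2 < 1" using norm_s3 by (simp add: abs_square_less_1)
  then have "(1 - s3)^2 * (norm w)^2 < 1"
    using n by (smt (verit, best) mult_left_le zero_le_power2)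
  then have "(1 - C^2) * (norm (1 - w))^2 * (1 - (1 - s3)^2 * (norm w)^2) > 0"
    using C2 assms by simp
  ultimately have "(norm (w * M3s w))^2 < (norm (M3 w))^2" using norm_M3_M3s[of w] by linarith
  then show ?thesis by (simp add: power2_less_imp_less)
qed

lemma at_1:
  "M1 1 = of_real s3" "M3 1 = of_real (s3 * C^2)" "M3s 1 = of_real (s3 * C^2)"
  "disp_a 1 = of_real (s3 * C * ((2 - s2) * C - s2))" "disp_b 1 = of_real (s3 * C * ((2 - s2) * C + s2))"
  by (simp_all add: M1_def M3_def M3s_def disp_a_def disp_b_def algebra_simps power2_eq_square)

text \<open>This is the equation of the rest population, M1 - M3 = w (M1 - M3s), rearranged.\<close>

lemma M3_minus: "M3 w - w * M3s w = (1 - w) * M1 w"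
  by (simp add: M1_def M3_def M3s_def algebra_simps)

lemma M3_plus_nz:
  assumes "norm w \<le> 1"
  shows "M3 w + w * M3s w \<noteq> 0"
proof (cases "w = 1")
  case True
  then show ?thesis using C s3 by (simp add: at_1 flip: of_real_mult of_real_add)
next
  case False
  then show ?thesis using M3s_less_M3[OF assms False]
    by (metis add_eq_0_iff norm_minus_cancel order_less_irrefl)
qed

text \<open>In terms of \<open>(1 - k) / (1 + k)\<close> the coefficients of the dispersion relation factorise, and the
  root \<open>k = 1\<close> at \<open>w = 1\<close> becomes visible.\<close>
lemma disp_symmetrised:
  "(1 + k)^2 * (1 - of_real (1 - s2) * w) * ((1 - w) * M1 w)
    - (1 - k)^2 * (1 + of_real (1 - s2) * w) * (M3 w + w * M3s w)
    - 2 * (1 - k^2) * w * of_real (s2 * C) * M1 w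
   = 2 * (k * (2 * disp_p w - w * disp_a w * k) - w * disp_b w)"
  unfolding M3_minus[symmetric] disp_p_def disp_a_def disp_b_def
  by (simp add: algebra_simps power2_eq_square)

lemma one_pm_s2_nz:
  fixes w :: complex
  assumes "norm w \<le> 1"
  shows "1 - of_real (1 - s2) * w \<noteq> 0" "1 + of_real (1 - s2) * w \<noteq> 0"
proof -
  show "1 - of_real (1 - s2) * w \<noteq> 0" using M2_denom_nz[of w 1] assms by simp
  have "1 + of_real (1 - s2) * w = 1 - of_real (1 - s2) * (-1) * w" by (simp add: algebra_simps)
  then show "1 + of_real (1 - s2) * w \<noteq> 0" using M2_denom_nz[of w "-1"] assms by (metis norm_minus_cancel norm_one order_refl)
qed

lemma disp_one_imp:
  assumes "norm w \<le> 1" "disp w 1"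
  shows "w = 1"
proof -
  have "1 * (2 * disp_p w - w * disp_a w * 1) - w * disp_b w = 0" using assms(2) by (simp add: disp_def)
  moreover have "4 * ((1 - of_real (1 - s2) * w) * ((1 - w) * M1 w)) = 2 * (1 * (2 * disp_p w - w * disp_a w * 1) - w * disp_b w)"
    using disp_symmetrised[of 1 w] by (simp add: algebra_simps)
  ultimately have "(1 - of_real (1 - s2) * w) * ((1 - w) * M1 w) = 0"
    by (metis mult_eq_0_iff zero_neq_numeral)
  then show ?thesis using one_pm_s2_nz[OF assms(1)] M1_nz[OF assms(1)] by simp
qed

lemma disp_at_1:
  assumes "disp 1 k"
  shows "k = 1 \<or> disp_a 1 * k = disp_b 1"
proof -
  have "2 * disp_p 1 = disp_a 1 + disp_b 1"
    by (simp add: disp_p_def disp_a_def disp_b_def at_1)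
  then have "(k - 1) * (disp_b 1 - disp_a 1 * k) = 0"
    using assms by (simp add: disp_def algebra_simps)
  then show ?thesis by auto
qed

text \<open>Locates the root of \<open>disp_a 1 * k = disp_b 1\<close> that accompanies k = 1 at w =
  1: inside the disc for C < 0, and absent from the closed disc for C > 0.\<close>

lemma norm_disp_at_1:
  "C < 0 \<Longrightarrow> norm (disp_b 1) < norm (disp_a 1)" "C > 0 \<Longrightarrow> norm (disp_a 1) < norm (disp_b 1)"
proof -
  have "\<bar>(2 - s2) * C + s2\<bar> < \<bar>(2 - s2) * C - s2\<bar>" if "C < 0"
    using mult_pos_neg[of "2 - s2" C] that s2 by linarith
  then show "C < 0 \<Longrightarrow> norm (disp_b 1) < norm (disp_a 1)"
    unfolding at_1 norm_of_real abs_mult using s3 by simp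
  have "\<bar>(2 - s2) * C - s2\<bar> < \<bar>(2 - s2) * C + s2\<bar>" if "C > 0"
    using mult_pos_pos[of "2 - s2" C] that s2 by linarith
  then show "C > 0 \<Longrightarrow> norm (disp_a 1) < norm (disp_b 1)"
    unfolding at_1 norm_of_real abs_mult using s3 by simp
qed

text \<open>The boundary equation z f2 = ghost, multiplied by w = 1/z so that it stays regular at w
  = 0; for the scalar space of stable modes the Kreiss-Lopatinskii determinant is this single
  number.\<close>

definition KL :: "bc \<Rightarrow> complex \<Rightarrow> complex \<Rightarrow> complex" where
  "KL b w k = f2 (mode w k) - w * ghost b (\<lambda>j. smul3 (k^j) (relaxC (mode w k)))"

text \<open>A compact set that will contain the graph of the stable root. The last inequality says
  that the companion root has modulus at least 1, written without dividing by
  \<open>w * disp_a w\<close>; for C < 0 it is what keeps the spurious pair (1, 1) out.\<close>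

definition stable_set :: "(complex \<times> complex) set" where
  "stable_set = {(w, k). norm w \<le> 1 \<and> norm k \<le> 1 \<and> disp w k
     \<and> norm (w * disp_a w) \<le> norm (2 * disp_p w - w * disp_a w * k)}"

text \<open>Multiplication by 1 - k allows the transport relations to replace k f2 by w f2* and k w
  f3* by f3, after which only the even moment is left. The price is that nothing is learnt at k =
  1.\<close>

lemma KL_BounceBack:
  assumes "norm w \<le> 1" "norm k \<le> 1" "disp w k"
  shows "KL BounceBack w k * (1 - k) = (1 - w) * M1 w"
proof -
  let ?F = "mode w k" and ?G = "relaxC (mode w k)"
  have "KL BounceBack w k * (1 - k) = f2 ?F + k * w * f3 ?G - w * f3 ?G - k * f2 ?F"
    by (simp add: KL_def smul3_def f1_def f2_def f3_def algebra_simps)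
  also have "\<dots> = (f2 ?F + f3 ?F) - w * (f3 ?G + f2 ?G)"
    unfolding mode_2[OF assms] mode_3[OF assms(1,2)] by (simp add: algebra_simps)
  also have "\<dots> = M3 w - w * M3s w"
    unfolding relax_mode by (simp add: mode_def f2_def f3_def field_simps)
  finally show ?thesis by (simp add: M3_minus)
qed

lemma KL_AntiBounceBack:
  assumes "norm w \<le> 1" "norm k \<le> 1" "disp w k"
  shows "KL AntiBounceBack w k * (1 + k) = M3 w + w * M3s w"
proof -
  let ?F = "mode w k" and ?G = "relaxC (mode w k)"
  have "KL AntiBounceBack w k * (1 + k) = f2 ?F + k * w * f3 ?G + w * f3 ?G + k * f2 ?F"
    by (simp add: KL_def smul3_def f1_def f2_def f3_def algebra_simps)
  also have "\<dots> = (f2 ?F + f3 ?F) + w * (f3 ?G + f2 ?G)"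
    unfolding mode_2[OF assms] mode_3[OF assms(1,2)] by (simp add: algebra_simps)
  also have "\<dots> = M3 w + w * M3s w"
    unfolding relax_mode by (simp add: mode_def f2_def f3_def field_simps)
  finally show ?thesis .
qed

text \<open>The boundary terms w f1* and k w f3* are f1 and f3 of the mode, so the condition
  prescribes the conserved moment itself.\<close>

lemma KL_TwoSteps:
  assumes "norm w \<le> 1" "norm k \<le> 1"
  shows "KL TwoStepsAntiBounceBack w k = M1 w"
proof -
  let ?F = "mode w k" and ?G = "relaxC (mode w k)"
  have "KL TwoStepsAntiBounceBack w k = f2 ?F + w * f1 ?G + k * w * f3 ?G"
    by (simp add: KL_def smul3_def f1_def f2_def f3_def algebra_simps)
  also have "\<dots> = f2 ?F + f1 ?F + f3 ?F"
    unfolding mode_1[symmetric] mode_3[OF assms, symmetric] by simp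
  also have "\<dots> = M1 w" by (simp add: mode_def f1_def f2_def f3_def field_simps)
  finally show ?thesis .
qed

lemma KL_Kinetic: "KL KineticDirichlet w k = f2 (mode w k)"
  by (simp add: KL_def)

lemma sum_alternating_binomial:
  fixes k :: "'a::comm_ring_1"
  shows "(\<Sum>j<n. (-1)^j * of_nat (n choose (j+1)) * k^(j+1)) = 1 - (1 - k)^n"
proof -
  have "(1 - k)^n = (\<Sum>j\<le>n. of_nat (n choose j) * (-k)^j)"
    using binomial_ring[of "-k" 1 n] by (simp add: add.commute)
  also have "\<dots> = 1 + (\<Sum>j<n. of_nat (n choose Suc j) * (-k)^Suc j)"
    by (simp add: sum.atMost_shift)
  also have "(\<Sum>j<n. of_nat (n choose Suc j) * (-k)^Suc j) = - (\<Sum>j<n. (-1)^j * of_nat (n choose (j+1)) * k^(j+1))"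
    unfolding sum_negf[symmetric]
  proof (intro sum.cong refl)
    fix j
    have "(-k)^Suc j = - ((-1)^j * k^(j+1))" by (subst power_minus) simp
    then show "of_nat (n choose Suc j) * (-k)^Suc j = - ((-1)^j * of_nat (n choose (j+1)) * k^(j+1))"
      by (simp add: mult_ac)
  qed
  finally show ?thesis by simp
qed

text \<open>Along a mode w f2* = k f2, so extrapolation of order n acts as the n-th difference, with
  symbol (1 - k)^n.\<close>

lemma KL_Extrapolation:
  assumes "norm w \<le> 1" "norm k \<le> 1" "disp w k"
  shows "KL (Extrapolation n) w k = f2 (mode w k) * (1 - k)^n"
proof -
  let ?F = "mode w k" and ?G = "relaxC (mode w k)"
  have "w * ghost (Extrapolation n) (\<lambda>j. smul3 (k^j) ?G)
      = (\<Sum>j<n. (-1)^j * of_nat (n choose (j+1)) * k^j * (w * f2 ?G))"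
    by (simp add: smul3_def f2_def sum_distrib_left mult_ac)
  also have "\<dots> = (\<Sum>j<n. (-1)^j * of_nat (n choose (j+1)) * k^(j+1)) * f2 ?F"
    unfolding mode_2[OF assms, symmetric] sum_distrib_right by (intro sum.cong) (simp_all add: mult_ac)
  also have "\<dots> = (1 - (1 - k)^n) * f2 ?F" by (simp only: sum_alternating_binomial)
  finally show ?thesis by (simp add: KL_def algebra_simps)
qed

text \<open>If f2 vanishes then so does f2*, and the third mode equation becomes M3 = k w M3s. The
  modulus comparison leaves only w = 1, where the relaxation of the second moment would force C (C +
  1) = 0.\<close>

lemma mode_2_nz:
  assumes w: "norm w \<le> 1" and k: "norm k \<le> 1" and d: "disp w k"
  shows "f2 (mode w k) \<noteq> 0"
proof
  assume 0: "f2 (mode w k) = 0"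
  then have "w * f2 (relaxC (mode w k)) = 0" using mode_2[OF assms] by simp
  show False
  proof (cases "w = 0")
    case True
    then show False using 0 by (simp add: mode_def f2_def M2_def M3_def)
  next
    case False
    then have G0: "f2 (relaxC (mode w k)) = 0" using mode_2[OF assms] 0 by simp
    have m2: "M2 w k = - M3 w" using 0 by (simp add: mode_def f2_def add_eq_0_iff2)
    have m2s: "M2s w k = - M3s w" using G0 unfolding relax_mode by (simp add: f2_def add_eq_0_iff2)
    have "M3 w = k * (w * M3s w)"
      using mode_3[OF w k] unfolding relax_mode by (simp add: mode_def f3_def m2 m2s)
    then have "norm (M3 w) \<le> norm (w * M3s w)"
      using k by (metis norm_mult mult_left_le_one_le norm_ge_zero)
    then have "w = 1" using M3s_less_M3[OF w] by force
    then have "of_real ((1 - s2) * (- (s3 * C^2)) + s2 * C * s3 + s3 * C^2) = (0::complex)"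
      using m2s m2 by (simp add: M2s_def at_1 algebra_simps)
    then have "s2 * s3 * C * (C + 1) = 0" 
      unfolding of_real_eq_0_iff by (simp add: algebra_simps power2_eq_square)
    then show False using s2 s3 C by simp
  qed
qed

lemma KL_nz:
  assumes "(w, k) \<in> stable_set"
  shows "KL AntiBounceBack w k \<noteq> 0" "KL TwoStepsAntiBounceBack w k \<noteq> 0" "KL KineticDirichlet w k \<noteq> 0"
    and "C > 0 \<Longrightarrow> KL BounceBack w k \<noteq> 0"
    and "C < 0 \<Longrightarrow> k \<noteq> 1"
    and "C < 0 \<Longrightarrow> KL (Extrapolation n) w k \<noteq> 0"
proof -
  have w: "norm w \<le> 1" and k: "norm k \<le> 1" and d: "disp w k"
    and le: "norm (w * disp_a w) \<le> norm (2 * disp_p w - w * disp_a w * k)"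
    using assms by (auto simp: stable_set_def)
  show "KL AntiBounceBack w k \<noteq> 0" using KL_AntiBounceBack[OF w k d] M3_plus_nz[OF w] by auto
  show "KL TwoStepsAntiBounceBack w k \<noteq> 0" using KL_TwoSteps[OF w k] M1_nz[OF w] by simp
  show "KL KineticDirichlet w k \<noteq> 0" using mode_2_nz[OF w k d] by (simp add: KL_Kinetic)
  show k1: "k \<noteq> 1" if "C < 0"
  proof
    assume k: "k = 1"
    then have "w = 1" using disp_one_imp[OF w] d by simp
    \<comment> \<open>At (1, 1) the companion root solves \<open>disp_a 1 * k = disp_b 1\<close>,
      hence would lie strictly inside the disc.\<close>
    then have "2 * disp_p w - w * disp_a w * k = disp_b 1" using d k by (simp add: disp_def)
    then show False using le \<open>w = 1\<close> norm_disp_at_1(1)[OF that] by simp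
  qed
  show "KL (Extrapolation n) w k \<noteq> 0" if "C < 0"
    using KL_Extrapolation[OF w k d] mode_2_nz[OF w k d] k1[OF that] by simp
  show "KL BounceBack w k \<noteq> 0" if Cp: "C > 0"
  proof
    assume 0: "KL BounceBack w k = 0"
    \<comment> \<open>From here k = 1 is a candidate, where \<open>KL_BounceBack\<close> is void, so
      the boundary equation is solved for \<open>M2\<close> directly.\<close>
    then have "w = 1" using KL_BounceBack[OF w k d] M1_nz[OF w] by simp
    have b: "f2 (mode 1 k) = f3 (relaxC (mode 1 k))"
      using 0 \<open>w = 1\<close> by (simp add: KL_def smul3_def f3_def)
    then have e1: "M3 1 + M2 1 k = M3s 1 - M2s 1 k"
    proof -
      have "(M3 1 + M2 1 k) / 2 = (M3s 1 - M2s 1 k) / 2"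
        using b unfolding relax_mode by (simp only: mode_def f2_def f3_def fst_conv snd_conv)
      then show ?thesis by (simp only: divide_cancel_right) simp
    qed
    have "of_real (2 - s2) * M2 1 k + of_real (s2 * C * s3) = M2 1 k + M2s 1 k"
      by (simp add: M2s_def at_1 algebra_simps)
    also have "\<dots> = 0" using e1 unfolding at_1 by (metis add_diff_cancel_left add.commute diff_add_cancel diff_self add_diff_eq)
    finally have "of_real (2 - s2) * M2 1 k + of_real (s2 * C * s3) = 0" .
    then have "of_real (2 - s2) * M2 1 k = of_real (2 - s2) * of_real (- (s2 * C * s3 / (2 - s2)))"
    proof -
      assume "of_real (2 - s2) * M2 1 k + of_real (s2 * C * s3) = 0"
      moreover have "(2 - s2) * - (s2 * C * s3 / (2 - s2)) = - (s2 * C * s3)" using s2 by simp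
      ultimately show ?thesis
        by (simp only: add_eq_0_iff2 flip: of_real_mult of_real_minus)
    qed
    moreover have "of_real (2 - s2) \<noteq> (0::complex)" using s2 by (simp only: of_real_eq_0_iff)
    ultimately have M2: "M2 1 k = of_real (- (s2 * C * s3 / (2 - s2)))" by (metis mult_cancel_left)
    have "M3 1 - M2 1 k = k * (M3 1 + M2 1 k)"
    proof -
      have "f3 (mode 1 k) = k * f2 (mode 1 k)" using mode_3[OF w k] \<open>w = 1\<close> unfolding b by simp
      then have "(M3 1 - M2 1 k) / 2 = (k * (M3 1 + M2 1 k)) / 2"
        by (simp only: mode_def f2_def f3_def fst_conv snd_conv times_divide_eq_right)
      then show ?thesis by (simp only: divide_cancel_right) simp
    qed
    then have "norm (M3 1 - M2 1 k) \<le> norm (M3 1 + M2 1 k)"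
      using k by (metis norm_mult mult_left_le_one_le norm_ge_zero)
    \<comment> \<open>Vanishing of KL at w = 1 gives f3 = k f2, hence |f3| \<le> |f2|; but for C > 0
      \<open>M2\<close> is negative and \<open>M3\<close> positive, which makes |M3 - M2| the larger
      modulus.\<close>
    then have "\<bar>s3 * C^2 + s2 * C * s3 / (2 - s2)\<bar> \<le> \<bar>s3 * C^2 - s2 * C * s3 / (2 - s2)\<bar>"
      unfolding M2 at_1 by (simp only: norm_of_real flip: of_real_add of_real_diff)
    moreover have "s3 * C^2 > 0" "s2 * C * s3 / (2 - s2) > 0" using s2 s3 C2 Cp by auto
    moreover have "\<not> \<bar>x + y\<bar> \<le> \<bar>x - y\<bar>" if "x > 0" "y > 0" for x y :: real using that by linarith
    ultimately show False by blast
  qed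
qed

end

section \<open>Absence of unimodular roots, and the spatial root with its compact set\<close>

context d1q3
begin

text \<open>With \<open>W = (1 + w) / (1 - w)\<close> and \<open>k = (1 - i \<tau>) / (1 + i \<tau>)\<close> the dispersion relation is the
  polynomial of lemma \<open>no_right_half_plane_root\<close>, with \<open>v = \<tau> C\<close> and \<open>S = \<tau>^2 (1 - C^2)\<close>.\<close>
lemma no_unimodular_root:
  assumes w: "norm w < 1" and k: "norm k = 1"
  shows "\<not> disp w k"
proof
  assume d: "disp w k"
  let ?a = "complex_of_real (1 - s2)"
  have sym: "(1 + k)^2 * (1 - ?a * w) * ((1 - w) * M1 w)
    - (1 - k)^2 * (1 + ?a * w) * (M3 w + w * M3s w)
    - 2 * (1 - k^2) * w * of_real (s2 * C) * M1 w = 0"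
    using disp_symmetrised[of k w] d by (simp add: disp_def)
  have w1: "w \<noteq> 1" using w by auto
  show False
  \<comment> \<open>k = -1 is the point at infinity of the variable t below; there only one term of
    the symmetrised relation remains.\<close>
  proof (cases "k = -1")
    case True
    then have "(1 - k)^2 * (1 + ?a * w) * (M3 w + w * M3s w) = 0" using sym by simp
    moreover have "1 - k \<noteq> 0" using True by simp
    ultimately show False using one_pm_s2_nz(2)[of w] M3_plus_nz[of w] w
      by (metis mult_eq_0_iff less_imp_le power_eq_0_iff)
  next
    case False
    then have k1: "1 + k \<noteq> 0" by (simp add: add_eq_0_iff)
    define t where "t = (1 - k) / (1 + k)"
    have "Re t = 0"
    proof -
      have "k * cnj k = 1" using k by (simp add: complex_norm_square[symmetric])
      moreover have "1 + cnj k \<noteq> 0" using k1 by (metis complex_cnj_add complex_cnj_one complex_cnj_zero complex_cnj_cnj)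
      ultimately have "t + cnj t = 0" using k1 unfolding t_def by (simp add: field_simps)
      then have "Re (t + cnj t) = 0" by simp
      then show ?thesis by simp
    qed
    then have tI: "t = \<i> * of_real (Im t)" by (simp add: complex_eq_iff)
    define \<tau> where "\<tau> = Im t"
    have tk: "1 - k = t * (1 + k)" using k1 by (simp add: t_def)
    have "(1 + k)^2 * ((1 - ?a * w) * ((1 - w) * M1 w) - t^2 * (1 + ?a * w) * (M3 w + w * M3s w)
        - 2 * t * w * of_real (s2 * C) * M1 w)
      = (1 + k)^2 * (1 - ?a * w) * ((1 - w) * M1 w) - (t * (1 + k))^2 * (1 + ?a * w) * (M3 w + w * M3s w)
        - 2 * (t * (1 + k)) * (1 + k) * w * of_real (s2 * C) * M1 w"
      by (simp add: algebra_simps power2_eq_square)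
    also have "\<dots> = (1 + k)^2 * (1 - ?a * w) * ((1 - w) * M1 w) - (1 - k)^2 * (1 + ?a * w) * (M3 w + w * M3s w)
        - 2 * ((1 - k) * (1 + k)) * w * of_real (s2 * C) * M1 w"
      unfolding tk[symmetric] by (simp only: mult.assoc)
    also have "(1 - k) * (1 + k) = 1 - k^2" by (simp add: algebra_simps power2_eq_square)
    finally have eq: "(1 - ?a * w) * ((1 - w) * M1 w) - t^2 * (1 + ?a * w) * (M3 w + w * M3s w)
        - 2 * t * w * of_real (s2 * C) * M1 w = 0"
      using sym k1 by simp
    define h where "h = (2 - s2) / s2"
    define l where "l = (2 - s3) / s3"
    define W where "W = (1 + w) / (1 - w)"
    define v where "v = \<tau> * C"
    define S where "S = \<tau>^2 * (1 - C^2)"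
    have hl: "h > 0" "l > 0" using s2 s3 by (auto simp: h_def l_def)
    have cond: "h + l \<le> h * l * (2 * h + l)" using stable by (simp add: h_def l_def)
    have S: "S \<ge> 0" "v = 0 \<Longrightarrow> S = 0" using C2 C by (auto simp: S_def v_def)
    have W: "Re W > 0"
    proof -
      have "Re W = (1 - (norm w)^2) / (norm (1 - w))^2"
        unfolding W_def Re_divide cmod_power2 by (simp add: power2_eq_square algebra_simps)
      moreover have "(norm w)^2 < 1" using w by (simp add: power_less_one_iff abs_square_less_1)
      ultimately show ?thesis using w1 by simp
    qed
    have Wm: "(1 - w) * W = 1 + w" using w1 by (simp add: W_def)
    have h1: "of_real s2 * (of_real h :: complex) = 2 - of_real s2"
      using s2 by (simp add: h_def flip: of_real_mult)
    have l1: "of_real s3 * (of_real l :: complex) = 2 - of_real s3"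
      using s3 by (simp add: l_def flip: of_real_mult)
    have e1: "of_real s2 * ((1 - w) * (W + of_real h)) = 2 * (1 - ?a * w)"
    proof -
      have "of_real s2 * ((1 - w) * (W + of_real h)) = of_real s2 * ((1 - w) * W) + (of_real s2 * of_real h) * (1 - w)"
        by (simp add: algebra_simps)
      then show ?thesis unfolding Wm h1 by (simp add: algebra_simps)
    qed
    have e2: "of_real s2 * ((1 - w) * (of_real h * W + 1)) = 2 * (1 + ?a * w)"
    proof -
      have "of_real s2 * ((1 - w) * (of_real h * W + 1)) = (of_real s2 * of_real h) * ((1 - w) * W) + of_real s2 * (1 - w)"
        by (simp add: algebra_simps)
      then show ?thesis unfolding Wm h1 by (simp add: algebra_simps)
    qed
    have e3: "of_real s3 * ((1 - w) * (W + of_real l)) = 2 * M1 w"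
    proof -
      have "of_real s3 * ((1 - w) * (W + of_real l)) = of_real s3 * ((1 - w) * W) + (of_real s3 * of_real l) * (1 - w)"
        by (simp add: algebra_simps)
      then show ?thesis unfolding Wm l1 by (simp add: M1_def algebra_simps)
    qed
    have e4: "of_real s3 * ((1 - w) * (of_real l * W + 1)) = 2 * (1 + of_real (1 - s3) * w)"
    proof -
      have "of_real s3 * ((1 - w) * (of_real l * W + 1)) = (of_real s3 * of_real l) * ((1 - w) * W) + of_real s3 * (1 - w)"
        by (simp add: algebra_simps)
      then show ?thesis unfolding Wm l1 by (simp add: algebra_simps)
    qed
    \<comment> \<open>The factor s2 s3 (1 - w)^3 clears the denominators hidden in h, l and W;
      \<open>e1\<close> to \<open>e4\<close> distribute it over the linear factors.\<close>
    have "of_real s2 * of_real s3 * (1 - w)^3 * ((W + l) * (1 - \<i> * v * W) * (W + h + \<i> * v * (h * W + 1))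
            + S * (h * W + 1) * (l * W + 1))
      = (of_real s3 * ((1 - w) * (W + of_real l))) * ((1 - w) - \<i> * v * ((1 - w) * W))
          * (of_real s2 * ((1 - w) * (W + of_real h)) + \<i> * v * (of_real s2 * ((1 - w) * (of_real h * W + 1))))
        + S * (of_real s2 * ((1 - w) * (of_real h * W + 1))) * (of_real s3 * ((1 - w) * (of_real l * W + 1))) * (1 - w)"
      by (simp add: algebra_simps power3_eq_cube)
    also have "\<dots> = 4 * ((1 - ?a * w) * ((1 - w) * M1 w) - t^2 * (1 + ?a * w) * (M3 w + w * M3s w)
        - 2 * t * w * of_real (s2 * C) * M1 w)"
    proof -
      have t: "t = \<i> * of_real \<tau>" using tI by (simp add: \<tau>_def)
      show ?thesis unfolding e1 e2 e3 e4 Wm t v_def S_def M1_def M3_def M3s_def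
        by (simp add: algebra_simps power2_eq_square)
    qed
    also have "\<dots> = 0" by (simp only: eq mult_zero_right)
    finally show False using no_right_half_plane_root[OF hl cond S W] w1 s2 s3 by simp
  qed
qed

definition spatial_root :: "complex \<Rightarrow> complex" where
  "spatial_root = (SOME \<kappa>. \<kappa> holomorphic_on ball 0 1 \<and> \<kappa> 0 = 0
     \<and> (\<forall>w. norm w < 1 \<longrightarrow> norm (\<kappa> w) < 1 \<and> (w, \<kappa> w) \<in> stable_set))"

lemma spatial_root:
  shows "spatial_root holomorphic_on ball 0 1" "spatial_root 0 = 0"
    and "\<And>w. norm w < 1 \<Longrightarrow> norm (spatial_root w) < 1"
    and "\<And>w. norm w < 1 \<Longrightarrow> (w, spatial_root w) \<in> stable_set"
proof -
  have hol: "disp_p holomorphic_on ball 0 1" "disp_a holomorphic_on ball 0 1" "disp_b holomorphic_on ball 0 1"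
    unfolding disp_p_def disp_a_def disp_b_def M1_def M3_def M3s_def by (auto intro!: holomorphic_intros)
  have p0: "disp_p 0 \<noteq> 0" by (simp add: disp_p_def M3_def)
  have ab: "disp_a w \<noteq> disp_b w" if "norm w < 1" for w
  proof
    assume "disp_a w = disp_b w"
    then have "of_real (s2 * C) * M1 w = 0" by (auto simp: disp_a_def disp_b_def)
    then show False using M1_nz[of w] that s2 C by auto
  qed
  have circ: "k * (2 * disp_p w - w * disp_a w * k) \<noteq> w * disp_b w" if "norm w < 1" "norm k = 1" for w k
    using no_unimodular_root[OF that] by (simp add: disp_def)
  obtain \<kappa> where "\<kappa> holomorphic_on ball 0 1" "\<kappa> 0 = 0" "\<And>w. norm w < 1 \<Longrightarrow> norm (\<kappa> w) < 1"
    "\<And>w. norm w < 1 \<Longrightarrow> \<kappa> w * (2 * disp_p w - w * disp_a w * \<kappa> w) = w * disp_b w"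
    "\<And>w. norm w < 1 \<Longrightarrow> norm (w * disp_a w) < norm (2 * disp_p w - w * disp_a w * \<kappa> w)"
    using holomorphic_stable_root[OF hol p0 ab circ] by blast
  then have "\<exists>\<kappa>. \<kappa> holomorphic_on ball 0 1 \<and> \<kappa> 0 = 0
     \<and> (\<forall>w. norm w < 1 \<longrightarrow> norm (\<kappa> w) < 1 \<and> (w, \<kappa> w) \<in> stable_set)"
    by (intro exI[of _ \<kappa>]) (auto simp: stable_set_def disp_def less_imp_le)
  then have *: "spatial_root holomorphic_on ball 0 1 \<and> spatial_root 0 = 0
     \<and> (\<forall>w. norm w < 1 \<longrightarrow> norm (spatial_root w) < 1 \<and> (w, spatial_root w) \<in> stable_set)"
    unfolding spatial_root_def by (rule someI_ex)
  then show "spatial_root holomorphic_on ball 0 1" "spatial_root 0 = 0"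
    "\<And>w. norm w < 1 \<Longrightarrow> norm (spatial_root w) < 1"
    "\<And>w. norm w < 1 \<Longrightarrow> (w, spatial_root w) \<in> stable_set" by auto
qed

lemma stable_setD:
  assumes "(w, k) \<in> stable_set"
  shows "norm w \<le> 1" "norm k \<le> 1" "disp w k"
  using assms by (auto simp: stable_set_def)

lemma compact_stable_set: "compact stable_set"
proof -
  have "stable_set \<subseteq> cball 0 1 \<times> cball 0 1" by (auto simp: stable_set_def)
  then have "bounded stable_set" by (rule bounded_subset[OF bounded_Times[OF bounded_cball bounded_cball]])
  moreover have "stable_set = {x. norm (fst x) \<le> 1} \<inter> {x. norm (snd x) \<le> 1}
     \<inter> {x. snd x * (2 * disp_p (fst x) - fst x * disp_a (fst x) * snd x) = fst x * disp_b (fst x)}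
     \<inter> {x. norm (fst x * disp_a (fst x)) \<le> norm (2 * disp_p (fst x) - fst x * disp_a (fst x) * snd x)}"
    by (auto simp: stable_set_def disp_def)
  moreover have "closed \<dots>"
    unfolding disp_p_def disp_a_def disp_b_def M1_def M3_def M3s_def
    by (intro closed_Int closed_Collect_le closed_Collect_eq continuous_intros)
  ultimately show ?thesis by (simp add: compact_eq_bounded_closed)
qed

lemma continuous_on_M2: "continuous_on stable_set (\<lambda>x. M2 (fst x) (snd x))"
proof -
  have "\<forall>x\<in>stable_set. 1 - of_real (1 - s2) * snd x * fst x \<noteq> 0"
    using M2_denom_nz stable_setD by (metis prod.collapse)
  then show ?thesis unfolding M2_def M1_def M3_def M3s_def by (intro continuous_intros) auto
qed

lemma continuous_on_KL: "continuous_on stable_set (\<lambda>x. KL b (fst x) (snd x))"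
  unfolding KL_def relax_mode
  by (cases b)
     (auto simp: mode_def smul3_def f1_def f2_def f3_def M2s_def M1_def M3_def M3s_def
       intro!: continuous_intros continuous_on_M2)

text \<open>The ratio of both sides is continuous on the compact \<open>stable_set\<close>; this is
  where pointwise nonvanishing becomes a uniform constant.\<close>

lemma mode_bounded_by_KL:
  assumes "\<And>w k. (w, k) \<in> stable_set \<Longrightarrow> KL b w k \<noteq> 0"
  obtains B where "B > 0" "\<And>w k. (w, k) \<in> stable_set \<Longrightarrow>
    (norm (M1 w))^2 + (norm (M2 w k))^2 + (norm (M3 w))^2 \<le> B * (norm (KL b w k))^2"
proof -
  let ?f = "\<lambda>x. ((norm (M1 (fst x)))^2 + (norm (M2 (fst x) (snd x)))^2 + (norm (M3 (fst x)))^2)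
    / (norm (KL b (fst x) (snd x)))^2"
  have "continuous_on stable_set ?f"
    using assms unfolding M1_def M3_def
    by (intro continuous_intros continuous_on_M2 continuous_on_KL) auto
  then have "bounded (?f ` stable_set)"
    using compact_continuous_image compact_imp_bounded compact_stable_set by blast
  then obtain B where B: "B > 0" "\<And>x. x \<in> stable_set \<Longrightarrow> norm (?f x) \<le> B"
    unfolding bounded_pos by auto
  show thesis
  proof (rule that[OF B(1)])
    fix w k assume m: "(w, k) \<in> stable_set"
    show "(norm (M1 w))^2 + (norm (M2 w k))^2 + (norm (M3 w))^2 \<le> B * (norm (KL b w k))^2"
      using B(2)[OF m] assms[OF m] by (simp add: divide_le_eq)
  qed
qed

end

section \<open>The solution as a power series\<close>

definition nth3 :: "complex fps \<times> complex fps \<times> complex fps \<Rightarrow> nat \<Rightarrow> complex \<times> complex \<times> complex" where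
  "nth3 T n = (fps_nth (f1 T) n, fps_nth (f2 T) n, fps_nth (f3 T) n)"

definition has_expansion3 ::
  "(complex \<Rightarrow> complex \<times> complex \<times> complex) \<Rightarrow> complex fps \<times> complex fps \<times> complex fps \<Rightarrow> bool" where
  "has_expansion3 u T \<longleftrightarrow> (\<lambda>w. f1 (u w)) has_fps_expansion f1 T \<and> (\<lambda>w. f2 (u w)) has_fps_expansion f2 T
     \<and> (\<lambda>w. f3 (u w)) has_fps_expansion f3 T"

lemma f_simps [simp]: "f1 (x, y, z) = x" "f2 (x, y, z) = y" "f3 (x, y, z) = z"
  by (simp_all add: f1_def f2_def f3_def)

lemma smul3_simps [simp]: "f1 (smul3 c T) = c * f1 T" "f2 (smul3 c T) = c * f2 T" "f3 (smul3 c T) = c * f3 T"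
  by (simp_all add: smul3_def)

lemma smul3_smul3: "smul3 c (smul3 d T) = smul3 (c * d) T" for c :: "'a::semigroup_mult"
  by (simp add: smul3_def mult.assoc)

lemma triple_eqI: "f1 x = f1 y \<Longrightarrow> f2 x = f2 y \<Longrightarrow> f3 x = f3 y \<Longrightarrow> x = y"
  by (cases x; cases y) auto

lemma ghost_smul3: "ghost b (\<lambda>j. smul3 c (T j)) = c * ghost b T"
  by (cases b) (simp_all add: algebra_simps sum_distrib_left)

text \<open>Brings the integer coefficients of the extrapolation into the \<open>fps_const\<close>
  shape to which the coefficient and expansion rules apply.\<close>

lemma fps_signed_of_nat: "(-1)^j * of_nat m = fps_const ((-1)^j * of_nat m :: complex)"
  by (cases "even j") (simp_all add: fps_of_nat[symmetric] flip: fps_const_neg)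

lemma ghost_nth: "fps_nth (ghost b T) n = ghost b (\<lambda>j. nth3 (T j) n)"
  by (cases b) (simp_all add: nth3_def fps_sum_nth fps_signed_of_nat)

lemma has_fps_expansion_ghost:
  assumes "\<And>j. has_expansion3 (\<lambda>w. u w j) (T j)"
  shows "(\<lambda>w. ghost b (u w)) has_fps_expansion ghost b T"
proof -
  note * = assms[unfolded has_expansion3_def]
  show ?thesis
    using * by (cases b) (auto simp: fps_signed_of_nat intro!: fps_expansion_intros)
qed

lemma has_expansion3_smul3:
  assumes "c has_fps_expansion c'" "has_expansion3 u T"
  shows "has_expansion3 (\<lambda>w. smul3 (c w) (u w)) (smul3 c' T)"
  using assms unfolding has_expansion3_def by (auto intro!: fps_expansion_intros)

context d1q3
begin

text \<open>\<open>relax\<close> requires a field, which formal power series are not; the halving is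
  therefore done by the constant 1/2.\<close>

definition relax_fps where
  "relax_fps T = (let m1 = f1 T + f2 T + f3 T; m2 = f2 T - f3 T; m3 = f2 T + f3 T;
         m2s = fps_const (of_real (1 - s2) :: complex) * m2 + fps_const (of_real (s2 * C)) * m1;
         m3s = fps_const (of_real (1 - s3)) * m3 + fps_const (of_real (s3 * C^2)) * m1
     in (m1 - m3s, fps_const (1/2) * (m3s + m2s), fps_const (1/2) * (m3s - m2s)))"

lemma nth3_relax_fps: "nth3 (relax_fps T) n = relaxC (nth3 T n)"
  by (simp add: relax_fps_def nth3_def relax_def moments_def Let_def)

lemma relax_fps_smul3: "relax_fps (smul3 c T) = smul3 c (relax_fps T)"
  by (simp add: relax_fps_def smul3_def Let_def algebra_simps)

lemma has_expansion3_relax: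
  assumes "has_expansion3 u T"
  shows "has_expansion3 (\<lambda>w. relaxC (u w)) (relax_fps T)"
proof -
  note * = assms[unfolded has_expansion3_def, THEN conjunct1]
    assms[unfolded has_expansion3_def, THEN conjunct2, THEN conjunct1]
    assms[unfolded has_expansion3_def, THEN conjunct2, THEN conjunct2]
  have r: "relaxC F = (let m1 = f1 F + f2 F + f3 F; m2 = f2 F - f3 F; m3 = f2 F + f3 F;
         m2s = of_real (1 - s2) * m2 + of_real (s2 * C) * m1;
         m3s = of_real (1 - s3) * m3 + of_real (s3 * C^2) * m1
     in (m1 - m3s, (1/2) * (m3s + m2s), (1/2) * (m3s - m2s)))" for F
    by (simp add: relax_def moments_def Let_def)
  show ?thesis
    unfolding has_expansion3_def r relax_fps_def Let_def f_simps
    by (intro conjI fps_expansion_intros *)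
qed

abbreviation root_mode :: "complex \<Rightarrow> complex \<times> complex \<times> complex" where
  "root_mode w \<equiv> mode w (spatial_root w)"

definition K :: "complex fps" where "K = fps_expansion spatial_root 0"
definition modeF :: "complex fps \<times> complex fps \<times> complex fps" where
  "modeF = (fps_expansion (\<lambda>w. f1 (root_mode w)) 0, fps_expansion (\<lambda>w. f2 (root_mode w)) 0,
     fps_expansion (\<lambda>w. f3 (root_mode w)) 0)"
definition KLF :: "bc \<Rightarrow> complex fps" where
  "KLF b = f2 modeF - fps_X * ghost b (\<lambda>j. smul3 (K^j) (relax_fps modeF))"

lemma holomorphic_M2: "(\<lambda>w. M2 w (spatial_root w)) holomorphic_on ball 0 1"
proof -
  have "1 - of_real (1 - s2) * spatial_root w * w \<noteq> 0" if "w \<in> ball 0 1" for w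
    using that M2_denom_nz[of w "spatial_root w"] spatial_root(3)[of w] by (simp add: less_imp_le)
  then show ?thesis unfolding M2_def M1_def M3_def M3s_def
    by (intro holomorphic_intros spatial_root(1)) auto
qed

lemma holomorphic_M1: "M1 holomorphic_on A" and holomorphic_M3: "M3 holomorphic_on A"
  unfolding M1_def M3_def by (auto intro!: holomorphic_intros)

lemma has_expansion_K: "spatial_root has_fps_expansion K"
  unfolding K_def using spatial_root(1) by (intro has_fps_expansion_fps_expansion[of "ball 0 1"]) auto

lemma has_expansion_mode: "has_expansion3 root_mode modeF"
proof -
  have "(\<lambda>w. f1 (root_mode w)) holomorphic_on ball 0 1" "(\<lambda>w. f2 (root_mode w)) holomorphic_on ball 0 1"
    "(\<lambda>w. f3 (root_mode w)) holomorphic_on ball 0 1"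
    unfolding mode_def f_simps by (intro holomorphic_intros holomorphic_M1 holomorphic_M2 holomorphic_M3; simp)+
  then show ?thesis unfolding has_expansion3_def modeF_def f_simps
    by (intro conjI has_fps_expansion_fps_expansion[of "ball 0 1"]) auto
qed

lemma has_expansion_KL: "(\<lambda>w. KL b w (spatial_root w)) has_fps_expansion KLF b"
proof -
  have "(\<lambda>w. ghost b (\<lambda>j. smul3 (spatial_root w^j) (relaxC (root_mode w))))
      has_fps_expansion ghost b (\<lambda>j. smul3 (K^j) (relax_fps modeF))"
    by (intro has_fps_expansion_ghost has_expansion3_smul3 has_fps_expansion_power has_expansion_K
        has_expansion3_relax has_expansion_mode)
  moreover have "(\<lambda>w. f2 (root_mode w)) has_fps_expansion f2 modeF"
    using has_expansion_mode by (simp add: has_expansion3_def)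
  ultimately show ?thesis unfolding KL_def KLF_def by (intro fps_expansion_intros)
qed

lemma fps_eqI_ball:
  fixes F G :: "complex fps"
  assumes "f has_fps_expansion F" "g has_fps_expansion G" "\<And>w. norm w < 1 \<Longrightarrow> f w = g w"
  shows "F = G"
proof -
  have "\<forall>\<^sub>F w in nhds 0. w \<in> ball (0::complex) 1" by (intro eventually_nhds_in_open) auto
  then have "\<forall>\<^sub>F w in nhds 0. f w = g w" by (rule eventually_mono) (simp add: assms(3))
  then have "g has_fps_expansion F" using assms(1) has_fps_expansion_cong by blast
  then show ?thesis using assms(2) fps_expansion_unique_complex by blast
qed

lemma modeF_1: "f1 modeF = fps_X * f1 (relax_fps modeF)"
  and modeF_2: "K * f2 modeF = fps_X * f2 (relax_fps modeF)"
  and modeF_3: "f3 modeF = K * fps_X * f3 (relax_fps modeF)"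
proof -
  have m: "(\<lambda>w. f1 (root_mode w)) has_fps_expansion f1 modeF" "(\<lambda>w. f2 (root_mode w)) has_fps_expansion f2 modeF"
    "(\<lambda>w. f3 (root_mode w)) has_fps_expansion f3 modeF"
    using has_expansion_mode by (auto simp: has_expansion3_def)
  have r: "(\<lambda>w. f1 (relaxC (root_mode w))) has_fps_expansion f1 (relax_fps modeF)"
    "(\<lambda>w. f2 (relaxC (root_mode w))) has_fps_expansion f2 (relax_fps modeF)"
    "(\<lambda>w. f3 (relaxC (root_mode w))) has_fps_expansion f3 (relax_fps modeF)"
    using has_expansion3_relax[OF has_expansion_mode] by (auto simp: has_expansion3_def)
  note s = stable_setD[OF spatial_root(4)]
  show "f1 modeF = fps_X * f1 (relax_fps modeF)"
    by (rule fps_eqI_ball[OF m(1) has_fps_expansion_mult[OF has_fps_expansion_fps_X r(1)]]) (rule mode_1)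
  show "K * f2 modeF = fps_X * f2 (relax_fps modeF)"
    by (rule fps_eqI_ball[OF has_fps_expansion_mult[OF has_expansion_K m(2)] has_fps_expansion_mult[OF has_fps_expansion_fps_X r(2)]])
       (rule mode_2[OF s])
  show "f3 modeF = K * fps_X * f3 (relax_fps modeF)"
    by (rule fps_eqI_ball[OF m(3) has_fps_expansion_mult[OF has_fps_expansion_mult[OF has_expansion_K has_fps_expansion_fps_X] r(3)]])
       (rule mode_3[OF s(1,2)])
qed

text \<open>The constant term is f2 of the mode at w = 0, namely 1, so \<open>KLF b\<close> is
  invertible formally even if KL has zeros in the disc.\<close>

lemma KLF_0: "fps_nth (KLF b) 0 \<noteq> 0"
proof -
  have "fps_nth (f2 modeF) 0 = f2 (root_mode 0)"
    using has_expansion_mode has_fps_expansion_imp_0_eq_fps_nth_0 by (metis has_expansion3_def)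
  also have "\<dots> = 1" by (simp add: mode_def M2_def M3_def)
  finally show ?thesis by (simp add: KLF_def)
qed

text \<open>The coefficient c = w g / KL as a formal quotient, meaningful for sources of any
  growth.\<close>

definition ampl :: "bc \<Rightarrow> (nat \<Rightarrow> real) \<Rightarrow> complex fps" where
  "ampl b g = fps_X * Abs_fps (\<lambda>n. of_real (g n)) * inverse (KLF b)"

lemma ampl_KLF: "ampl b g * KLF b = fps_X * Abs_fps (\<lambda>n. of_real (g n))"
  using inverse_mult_eq_1[OF KLF_0, of b] by (simp add: ampl_def mult.assoc)

definition cplx3 :: "real \<times> real \<times> real \<Rightarrow> complex \<times> complex \<times> complex" where
  "cplx3 T = (of_real (f1 T), of_real (f2 T), of_real (f3 T))"

lemma cplx3_relax: "cplx3 (relax C s2 s3 T) = relaxC (cplx3 T)"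
  by (simp add: cplx3_def relax_def moments_def Let_def)

lemma of_real_ghost: "of_real (ghost b T) = ghost b (\<lambda>j. cplx3 (T j))"
  by (cases b) (simp_all add: cplx3_def)

text \<open>The coefficients of c \<kappa>^j F satisfy the recursion of the scheme: the mode
  equations give transport in the interior, and the definition of c gives the ghost value. The
  factor \<open>fps_X\<close> in \<open>ampl\<close> accounts for the zero initial data.\<close>

lemma lbm_eq_fps: "cplx3 (lbm b C s2 s3 g n j) = nth3 (smul3 (ampl b g * K^j) modeF) n"
proof (induction n arbitrary: j)
  case 0
  have "fps_nth (ampl b g) 0 = 0" by (simp add: ampl_def)
  then show ?case by (simp add: cplx3_def nth3_def)
next
  case (Suc n)
  define V where "V = (\<lambda>j. smul3 (ampl b g * K^j) modeF)"
  have RV: "relax_fps (V j) = smul3 (ampl b g * K^j) (relax_fps modeF)" for j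
    by (simp add: V_def relax_fps_smul3)
  have V1: "f1 (V j) = fps_X * f1 (relax_fps (V j))" for j
    unfolding RV by (simp add: V_def) (subst modeF_1, simp add: mult_ac)
  have V3: "f3 (V j) = fps_X * f3 (relax_fps (V (Suc j)))" for j
    unfolding RV by (simp add: V_def) (subst modeF_3, simp add: mult_ac)
  have V2: "f2 (V (Suc j)) = fps_X * f2 (relax_fps (V j))" for j
  proof -
    have "f2 (V (Suc j)) = ampl b g * K^j * (K * f2 modeF)" by (simp add: V_def mult_ac)
    also have "\<dots> = fps_X * f2 (relax_fps (V j))" unfolding modeF_2 RV by (simp add: mult_ac)
    finally show ?thesis .
  qed
  \<comment> \<open>By linearity of \<open>ghost\<close> in the amplitude this is the identity
    \<open>ampl_KLF\<close>.\<close>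
  have V20: "f2 (V 0) = fps_X * (ghost b (\<lambda>j. relax_fps (V j)) + Abs_fps (\<lambda>n. of_real (g n)))"
  proof -
    have "ghost b (\<lambda>j. relax_fps (V j)) = ampl b g * ghost b (\<lambda>j. smul3 (K^j) (relax_fps modeF))"
      unfolding RV smul3_smul3[symmetric] by (rule ghost_smul3)
    then have "fps_X * (ghost b (\<lambda>j. relax_fps (V j)) + Abs_fps (\<lambda>n. of_real (g n)))
      = ampl b g * (fps_X * ghost b (\<lambda>j. smul3 (K^j) (relax_fps modeF))) + ampl b g * KLF b"
      unfolding ampl_KLF by (simp add: algebra_simps)
    also have "\<dots> = f2 (V 0)" by (simp add: KLF_def V_def algebra_simps)
    finally show ?thesis by simp
  qed
  have IH: "cplx3 (relax C s2 s3 (lbm b C s2 s3 g n j)) = nth3 (relax_fps (V j)) n" for j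
    unfolding cplx3_relax nth3_relax_fps Suc.IH V_def ..
  have c1: "complex_of_real (f1 T) = f1 (cplx3 T)" "complex_of_real (f2 T) = f2 (cplx3 T)"
    "complex_of_real (f3 T) = f3 (cplx3 T)" for T
    by (simp_all add: cplx3_def)
  have gh: "of_real (ghost b (\<lambda>j. relax C s2 s3 (lbm b C s2 s3 g n j)))
      = fps_nth (ghost b (\<lambda>j. relax_fps (V j))) n"
    unfolding of_real_ghost IH ghost_nth ..
  show ?case
  proof (rule triple_eqI)
    have "f1 (cplx3 (lbm b C s2 s3 g (Suc n) j)) = f1 (nth3 (relax_fps (V j)) n)"
      unfolding IH[symmetric] by (simp add: cplx3_def Let_def)
    also have "\<dots> = f1 (nth3 (V j) (Suc n))" using V1[of j] by (simp add: nth3_def)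
    finally show "f1 (cplx3 (lbm b C s2 s3 g (Suc n) j)) = f1 (nth3 (smul3 (ampl b g * K^j) modeF) (Suc n))"
      by (simp add: V_def)
    have "f3 (cplx3 (lbm b C s2 s3 g (Suc n) j)) = f3 (nth3 (relax_fps (V (Suc j))) n)"
      unfolding IH[symmetric] by (simp add: cplx3_def Let_def)
    also have "\<dots> = f3 (nth3 (V j) (Suc n))" using V3[of j] by (simp add: nth3_def)
    finally show "f3 (cplx3 (lbm b C s2 s3 g (Suc n) j)) = f3 (nth3 (smul3 (ampl b g * K^j) modeF) (Suc n))"
      by (simp add: V_def)
    have "f2 (cplx3 (lbm b C s2 s3 g (Suc n) j)) = f2 (nth3 (V j) (Suc n))"
    proof (cases j)
      case 0
      have "f2 (cplx3 (lbm b C s2 s3 g (Suc n) j))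
        = of_real (ghost b (\<lambda>j. relax C s2 s3 (lbm b C s2 s3 g n j))) + of_real (g n)"
        by (simp add: cplx3_def Let_def 0)
      also have "\<dots> = f2 (nth3 (V j) (Suc n))" unfolding gh 0 using V20 by (simp add: nth3_def)
      finally show ?thesis .
    next
      case (Suc i)
      have "f2 (cplx3 (lbm b C s2 s3 g (Suc n) j)) = f2 (nth3 (relax_fps (V i)) n)"
        unfolding IH[symmetric] by (simp add: cplx3_def Let_def Suc)
      also have "\<dots> = f2 (nth3 (V j) (Suc n))" using V2[of i] by (simp add: nth3_def Suc)
      finally show ?thesis .
    qed
    then show "f2 (cplx3 (lbm b C s2 s3 g (Suc n) j)) = f2 (nth3 (smul3 (ampl b g * K^j) modeF) (Suc n))"
      by (simp add: V_def)
  qed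
qed

end

section \<open>Strong stability\<close>

text \<open>Causality: the source may be cut off after the time range under consideration.\<close>

lemma lbm_cong:
  assumes "\<And>k. k < n \<Longrightarrow> g k = g' k"
  shows "lbm b C s2 s3 g n = lbm b C s2 s3 g' n"
  using assms by (induction n) (simp_all add: Let_def)

lemma suminf_suminf_le:
  fixes f :: "nat \<Rightarrow> nat \<Rightarrow> ennreal"
  assumes "\<And>J N. (\<Sum>j<J. \<Sum>n<N. f n j) \<le> X"
  shows "(\<Sum>n. \<Sum>j. f n j) \<le> X"
  unfolding suminf_eq_SUP[of "\<lambda>n. \<Sum>j. f n j"]
proof (rule SUP_least)
  fix N
  have "(\<Sum>n<N. \<Sum>j. f n j) = (\<Sum>j. \<Sum>n<N. f n j)" by (rule suminf_sum[symmetric]) simp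
  also have "\<dots> \<le> X" unfolding suminf_eq_SUP by (rule SUP_least) (rule assms)
  finally show "(\<Sum>n<N. \<Sum>j. f n j) \<le> X" .
qed

lemma moments_smul3: "moments (smul3 c T) = smul3 c (moments T)" for c :: "'a::comm_ring"
  by (simp add: moments_def smul3_def algebra_simps)

lemma moments_nth3: "moments (nth3 T n) = nth3 (moments T) n"
  by (simp add: moments_def nth3_def)

lemma has_expansion3_moments:
  assumes "has_expansion3 u T"
  shows "has_expansion3 (\<lambda>w. moments (u w)) (moments T)"
  using assms unfolding has_expansion3_def moments_def f_simps
  by (intro conjI fps_expansion_intros) auto

lemma geometric_sum_le:
  fixes x y :: real
  assumes "0 \<le> x" "x \<le> y" "y < 1"
  shows "(\<Sum>j<J. x^j) \<le> 1 / (1 - y)"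
proof -
  have "(\<Sum>j<J. x^j) \<le> (\<Sum>j. x^j)" using assms by (intro sum_le_suminf summable_geometric) auto
  also have "\<dots> = 1 / (1 - x)" using assms by (simp add: suminf_geometric)
  also have "\<dots> \<le> 1 / (1 - y)" using assms by (intro divide_left_mono) auto
  finally show ?thesis .
qed

context d1q3
begin

lemma moments_cplx3: "moments (cplx3 T) = cplx3 (moments T)"
  by (simp add: moments_def cplx3_def)

lemma moments_lbm:
  "cplx3 (moments (lbm b C s2 s3 g n j)) = nth3 (smul3 (ampl b g * K^j) (moments modeF)) n"
  unfolding moments_cplx3[symmetric] lbm_eq_fps moments_nth3 moments_smul3 ..

lemma msq_cplx3: "msq T = (norm (f1 (cplx3 T)))^2 + (norm (f2 (cplx3 T)))^2 + (norm (f3 (cplx3 T)))^2"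
  by (simp add: msq_def cplx3_def)

lemma holomorphic_KL: "(\<lambda>w. KL b w (spatial_root w)) holomorphic_on ball 0 1"
  unfolding KL_def relax_mode
  by (cases b)
     (auto simp: mode_def smul3_def M2s_def M1_def M3_def M3s_def
       intro!: holomorphic_intros holomorphic_M2 spatial_root(1))

lemma norm_spatial_root_le: "norm w < 1 \<Longrightarrow> norm (spatial_root w) \<le> norm w"
  using Schwarz_Lemma(1)[OF spatial_root(1,2,3)] by blast

text \<open>Parseval at radius r turns the sum over n into an integral over the circle for each j;
  there the sum over j is geometric with ratio at most r^2 and the mode is controlled by KL, leaving
  the norm of the source.\<close>

lemma energy_bound:
  assumes nz: "\<And>w k. (w, k) \<in> stable_set \<Longrightarrow> KL b w k \<noteq> 0"
    and B: "B > 0" "\<And>w k. (w, k) \<in> stable_set \<Longrightarrow>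
      (norm (M1 w))^2 + (norm (M2 w k))^2 + (norm (M3 w))^2 \<le> B * (norm (KL b w k))^2"
    and r: "0 \<le> r" "r < 1"
  shows "(\<Sum>j<J. \<Sum>n<N. r^(2*n) * msq (moments (lbm b C s2 s3 g n j)))
    \<le> B / (1 - r^2) * (\<Sum>n<N. r^(2*n) * (g n)^2)"
proof -
  \<comment> \<open>With the truncated source the generating function G is a polynomial, so no
    growth condition on g is needed.\<close>
  define g' where "g' = (\<lambda>n. if n < N then g n else 0)"
  have lbm_g': "lbm b C s2 s3 g n j = lbm b C s2 s3 g' n j" if "n < N" for n j
    using lbm_cong[of n g g'] that by (simp add: g'_def)
  define G where "G = (\<lambda>w::complex. \<Sum>n<N. of_real (g n) * w^n)"
  have Gh: "G holomorphic_on ball 0 1" unfolding G_def by (intro holomorphic_intros)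
  have GF: "G has_fps_expansion Abs_fps (\<lambda>n. of_real (g' n))"
  proof -
    have "G has_fps_expansion (\<Sum>n<N. fps_const (of_real (g n)) * fps_X^n)"
      unfolding G_def by (intro fps_expansion_intros)
    also have "(\<Sum>n<N. fps_const (of_real (g n)) * fps_X^n) = Abs_fps (\<lambda>n. of_real (g' n) :: complex)"
    proof (rule fps_ext)
      fix m
      have "fps_nth (\<Sum>n<N. fps_const (of_real (g n)) * fps_X^n) m
        = (\<Sum>n<N. if n = m then of_real (g n) else (0::complex))"
        unfolding fps_sum_nth by (intro sum.cong refl) (simp add: fps_X_power_nth)
      also have "\<dots> = fps_nth (Abs_fps (\<lambda>n. of_real (g' n))) m" by (simp add: g'_def)
      finally show "fps_nth (\<Sum>n<N. fps_const (of_real (g n)) * fps_X^n) m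
        = fps_nth (Abs_fps (\<lambda>n. of_real (g' n) :: complex)) m" .
    qed
    finally show ?thesis .
  qed
  define c where "c = (\<lambda>w. w * G w * inverse (KL b w (spatial_root w)))"
  have KLnz: "KL b w (spatial_root w) \<noteq> 0" if "norm w < 1" for w
    using nz[OF spatial_root(4)[OF that]] .
  have ch: "c holomorphic_on ball 0 1"
    unfolding c_def using KLnz by (intro holomorphic_intros Gh holomorphic_KL) auto
  have cF: "c has_fps_expansion ampl b g'"
    unfolding c_def ampl_def
    using KLF_0 by (intro fps_expansion_intros GF has_expansion_KL)
  define u where "u = (\<lambda>j w. smul3 (c w * spatial_root w^j) (M1 w, M2 w (spatial_root w), M3 w))"
  define T where "T = (\<lambda>j. smul3 (ampl b g' * K^j) (moments modeF))"
  have uT: "has_expansion3 (u j) (T j)" for j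
    unfolding u_def T_def moments_mode[symmetric]
    by (intro has_expansion3_smul3 has_fps_expansion_mult cF has_fps_expansion_power has_expansion_K
        has_expansion3_moments has_expansion_mode)
  have uh: "(\<lambda>w. f1 (u j w)) holomorphic_on ball 0 1" "(\<lambda>w. f2 (u j w)) holomorphic_on ball 0 1"
    "(\<lambda>w. f3 (u j w)) holomorphic_on ball 0 1" for j
    unfolding u_def smul3_simps f_simps
    by (intro holomorphic_intros ch spatial_root(1) holomorphic_M1 holomorphic_M2 holomorphic_M3)+
  note uT' = uT[unfolded has_expansion3_def, THEN conjunct1]
    uT[unfolded has_expansion3_def, THEN conjunct2, THEN conjunct1]
    uT[unfolded has_expansion3_def, THEN conjunct2, THEN conjunct2]
  define Q where "Q = (\<lambda>j t. (cmod (f1 (u j (of_real r * cis t))))^2 + (cmod (f2 (u j (of_real r * cis t))))^2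
     + (cmod (f3 (u j (of_real r * cis t))))^2)"
  define q where "q = (\<lambda>j n. msq (moments (lbm b C s2 s3 g' n j)) * r^(2*n))"
  have q: "q j n = (cmod (fps_nth (f1 (T j)) n))^2 * r^(2*n) + (cmod (fps_nth (f2 (T j)) n))^2 * r^(2*n)
      + (cmod (fps_nth (f3 (T j)) n))^2 * r^(2*n)" for j n
    unfolding q_def msq_cplx3 moments_lbm T_def nth3_def f_simps by (simp add: algebra_simps)
  have qs: "summable (q j)" for j
    unfolding q by (intro summable_add parseval_circle(2)[OF uh(1) uT'(1) r]
        parseval_circle(2)[OF uh(2) uT'(2) r] parseval_circle(2)[OF uh(3) uT'(3) r])
  have q0: "q j n \<ge> 0" for j n using r by (simp add: q_def msq_def)
  have Qint: "(Q j has_integral 2 * pi * suminf (q j)) {0..2*pi}" for j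
  proof -
    have "2 * pi * suminf (q j) = 2 * pi * (\<Sum>n. (cmod (fps_nth (f1 (T j)) n))^2 * r^(2*n))
      + 2 * pi * (\<Sum>n. (cmod (fps_nth (f2 (T j)) n))^2 * r^(2*n))
      + 2 * pi * (\<Sum>n. (cmod (fps_nth (f3 (T j)) n))^2 * r^(2*n))"
      unfolding q
      by (simp add: suminf_add[symmetric] summable_add parseval_circle(2)[OF uh(1) uT'(1) r]
        parseval_circle(2)[OF uh(2) uT'(2) r] parseval_circle(2)[OF uh(3) uT'(3) r] distrib_left)
    then show ?thesis unfolding Q_def
      by (simp only:) (intro has_integral_add parseval_circle(1)[OF uh(1) uT'(1) r]
        parseval_circle(1)[OF uh(2) uT'(2) r] parseval_circle(1)[OF uh(3) uT'(3) r])
  qed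
  have Qsum: "((\<lambda>t. \<Sum>j<J. Q j t) has_integral (\<Sum>j<J. 2 * pi * suminf (q j))) {0..2*pi}"
    by (intro has_integral_sum Qint) auto
  have gsum: "(\<Sum>n. (cmod (fps_nth (Abs_fps (\<lambda>n. of_real (g' n))) n))^2 * r^(2*n)) = (\<Sum>n<N. r^(2*n) * (g n)^2)"
    by (subst suminf_finite[of "{..<N}"]) (auto simp: g'_def mult.commute)
  have Gint: "((\<lambda>t. (cmod (G (of_real r * cis t)))^2) has_integral
      2 * pi * (\<Sum>n<N. r^(2*n) * (g n)^2)) {0..2*pi}"
    using parseval_circle(1)[OF Gh GF r] unfolding gsum .
  have r2: "r^2 < 1" using r by (simp add: abs_square_less_1)
  have pw: "(\<Sum>j<J. Q j t) \<le> B / (1 - r^2) * (cmod (G (of_real r * cis t)))^2" for t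
  proof -
    define w where "w = of_real r * cis t"
    have nw: "norm w = r" using r by (simp add: w_def norm_mult)
    then have w1: "norm w < 1" using r by simp
    define x where "x = (norm (spatial_root w))^2"
    have x: "0 \<le> x" "x \<le> r^2"
      using norm_spatial_root_le[OF w1] nw by (auto simp: x_def power_mono)
    define m where "m = (norm (M1 w))^2 + (norm (M2 w (spatial_root w)))^2 + (norm (M3 w))^2"
    have m: "m \<le> B * (norm (KL b w (spatial_root w)))^2" unfolding m_def by (rule B(2)[OF spatial_root(4)[OF w1]])
    have Qj: "Q j t = (norm (c w))^2 * m * x^j" for j
      unfolding Q_def w_def[symmetric] u_def smul3_simps f_simps norm_mult norm_power m_def x_def
      by (simp add: algebra_simps power_mult_distrib flip: power_mult)
    have cm: "(norm (c w))^2 * m \<le> B * (norm (G w))^2"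
    proof -
      have "(norm (c w))^2 * m \<le> (norm (c w))^2 * (B * (norm (KL b w (spatial_root w)))^2)"
        using m by (intro mult_left_mono) auto
      also have "\<dots> = B * (norm (c w * KL b w (spatial_root w)))^2"
        by (simp add: norm_mult power_mult_distrib)
      also have "c w * KL b w (spatial_root w) = w * G w" using KLnz[OF w1] by (simp add: c_def)
      also have "B * (norm (w * G w))^2 \<le> B * (norm (G w))^2"
      proof -
        have "norm (w * G w) \<le> norm (G w)" using w1 by (simp add: norm_mult mult_left_le_one_le)
        then show ?thesis using B(1) by (simp add: power_mono)
      qed
      finally show ?thesis .
    qed
    have "(\<Sum>j<J. Q j t) = (norm (c w))^2 * m * (\<Sum>j<J. x^j)" unfolding Qj by (simp add: sum_distrib_left)
    also have "\<dots> \<le> (B * (norm (G w))^2) * (1 / (1 - r^2))"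
      by (rule mult_mono[OF cm geometric_sum_le[OF x r2]]) (use B(1) x(1) in \<open>auto intro: sum_nonneg\<close>)
    finally show ?thesis by (simp add: w_def)
  qed
  have "(\<Sum>j<J. 2 * pi * suminf (q j)) \<le> B / (1 - r^2) * (2 * pi * (\<Sum>n<N. r^(2*n) * (g n)^2))"
    by (rule has_integral_le[OF Qsum has_integral_mult_right[OF Gint]]) (rule pw)
  then have "2 * pi * (\<Sum>j<J. suminf (q j)) \<le> 2 * pi * (B / (1 - r^2) * (\<Sum>n<N. r^(2*n) * (g n)^2))"
    by (simp add: sum_distrib_left mult_ac)
  then have le: "(\<Sum>j<J. suminf (q j)) \<le> B / (1 - r^2) * (\<Sum>n<N. r^(2*n) * (g n)^2)"
    by (simp only: mult_le_cancel_left_pos[OF mult_pos_pos[OF zero_less_numeral pi_gt_zero]])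
  have "(\<Sum>j<J. \<Sum>n<N. r^(2*n) * msq (moments (lbm b C s2 s3 g n j))) = (\<Sum>j<J. \<Sum>n<N. q j n)"
    by (intro sum.cong refl) (simp add: q_def lbm_g' mult.commute)
  also have "\<dots> \<le> (\<Sum>j<J. suminf (q j))"
    using q0 by (intro sum_mono sum_le_suminf qs) auto
  finally show ?thesis using le by linarith
qed

lemma SS_estimateI:
  assumes lam: "lam > 0" and nz: "\<And>w k. (w, k) \<in> stable_set \<Longrightarrow> KL b w k \<noteq> 0"
  shows "SS_estimate b C s2 s3 lam"
proof -
  obtain B where B: "B > 0" "\<And>w k. (w, k) \<in> stable_set \<Longrightarrow>
      (norm (M1 w))^2 + (norm (M2 w k))^2 + (norm (M3 w))^2 \<le> B * (norm (KL b w k))^2"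
    using mode_bounded_by_KL[OF nz] by blast
  show ?thesis unfolding SS_estimate_def
  proof (intro exI[of _ "lam * B"] conjI allI impI)
    show "lam * B > 0" using lam B by simp
    fix \<alpha> dx :: real and g :: "nat \<Rightarrow> real" assume \<alpha>: "\<alpha> > 0" and dx: "dx > 0"
    define dt where "dt = dx / lam"
    have dt: "dt > 0" using dx lam by (simp add: dt_def)
    define r where "r = exp (- (\<alpha> * dt))"
    have r: "0 \<le> r" "r < 1" using \<alpha> dt by (auto simp: r_def)
    have r2: "r^2 < 1" using r by (simp add: abs_square_less_1)
    have er: "exp (- 2 * \<alpha> * real n * dt) = r^(2*n)" for n
      unfolding r_def by (simp add: exp_of_nat_mult[symmetric] mult_ac)
    define R where "R = (\<Sum>n. ennreal (dt * exp (- 2 * \<alpha> * real n * dt) * (g n)^2))"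
    define L where "L = (\<Sum>n. \<Sum>j. ennreal (dt * dx * exp (- 2 * \<alpha> * real n * dt)
                    * msq (moments (lbm b C s2 s3 g n j))))"
    have L: "L \<le> ennreal (dx * B / (1 - r^2)) * R"
      unfolding L_def
    proof (rule suminf_suminf_le)
      fix J N
      have "(\<Sum>j<J. \<Sum>n<N. ennreal (dt * dx * exp (- 2 * \<alpha> * real n * dt) * msq (moments (lbm b C s2 s3 g n j))))
        = ennreal (dt * dx * (\<Sum>j<J. \<Sum>n<N. r^(2*n) * msq (moments (lbm b C s2 s3 g n j))))"
        unfolding er using dt dx r
        by (simp add: sum_ennreal sum_nonneg msq_def sum_distrib_left mult_ac)
      also have "\<dots> \<le> ennreal (dt * dx * (B / (1 - r^2) * (\<Sum>n<N. r^(2*n) * (g n)^2)))"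
        using energy_bound[OF nz B r, where J = J and N = N and g = g] dt dx by (intro ennreal_leI mult_left_mono) auto
      also have "\<dots> = ennreal (dx * B / (1 - r^2) * (\<Sum>n<N. dt * r^(2*n) * (g n)^2))"
        by (simp add: sum_distrib_left mult_ac)
      also have "\<dots> = ennreal (dx * B / (1 - r^2)) * (\<Sum>n<N. ennreal (dt * exp (- 2 * \<alpha> * real n * dt) * (g n)^2))"
      proof -
        have "ennreal (\<Sum>n<N. dt * r^(2*n) * (g n)^2) = (\<Sum>n<N. ennreal (dt * r^(2*n) * (g n)^2))"
          using dt r by (intro sum_ennreal[symmetric]) auto
        moreover have "ennreal (dx * B / (1 - r^2) * (\<Sum>n<N. dt * r^(2*n) * (g n)^2))
            = ennreal (dx * B / (1 - r^2)) * ennreal (\<Sum>n<N. dt * r^(2*n) * (g n)^2)"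
          using dt dx r r2 B(1) by (intro ennreal_mult sum_nonneg) auto
        ultimately show ?thesis unfolding er by simp
      qed
      also have "\<dots> \<le> ennreal (dx * B / (1 - r^2)) * R"
        unfolding R_def by (intro mult_left_mono sum_le_suminf) auto
      finally show "(\<Sum>j<J. \<Sum>n<N. ennreal (dt * dx * exp (- 2 * \<alpha> * real n * dt) * msq (moments (lbm b C s2 s3 g n j))))
        \<le> ennreal (dx * B / (1 - r^2)) * R" .
    qed
    \<comment> \<open>With a = \<alpha> dt the Parseval loss is 1/(1 - exp(-2a)), and 1 - exp(-2a)
      \<ge> a/(1 + a) shows that the prefactor of the estimate absorbs it. The remaining dx/dt = lam
      gives the constant lam B.\<close>
    have le: "\<alpha> / (1 + \<alpha> * dt) * (dx * B / (1 - r^2)) \<le> lam * B"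
    proof -
      define a where "a = \<alpha> * dt"
      have a: "a > 0" using \<alpha> dt by (simp add: a_def)
      have "1 + a \<le> exp (2 * a)" using exp_ge_add_one_self[of "2 * a"] a by linarith
      then have "exp (- (2 * a)) \<le> 1 / (1 + a)" using a by (simp add: exp_minus field_simps)
      moreover have "r^2 = exp (- (2 * a))" by (simp add: r_def a_def exp_double[symmetric] flip: exp_of_nat_mult)
      ultimately have "a / (1 + a) \<le> 1 - r^2" using a by (simp add: field_simps)
      then have q: "a / (1 + a) / (1 - r^2) \<le> 1" using r2 by (subst pos_divide_le_eq) simp_all
      have "\<alpha> * dx = lam * a" using lam by (simp add: a_def dt_def)
      then have "\<alpha> / (1 + \<alpha> * dt) * (dx * B / (1 - r^2)) = lam * B * (a / (1 + a) / (1 - r^2))"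
        unfolding a_def[symmetric] by (simp add: mult_ac)
      also have "\<dots> \<le> lam * B * 1" using q lam B by (intro mult_left_mono) auto
      finally show ?thesis by simp
    qed
    have "ennreal (\<alpha> / (1 + \<alpha> * dt)) * L \<le> ennreal (\<alpha> / (1 + \<alpha> * dt)) * (ennreal (dx * B / (1 - r^2)) * R)"
      using L by (intro mult_left_mono) auto
    also have "\<dots> = ennreal (\<alpha> / (1 + \<alpha> * dt) * (dx * B / (1 - r^2))) * R"
      using \<alpha> dt dx B r2 by (subst ennreal_mult) (auto simp: mult.assoc)
    also have "\<dots> \<le> ennreal (lam * B) * R"
      using le by (intro mult_right_mono ennreal_leI) auto
    finally show "ennreal (\<alpha> / (1 + \<alpha> * (dx / lam))) *
         (\<Sum>n. \<Sum>j. ennreal ((dx / lam) * dx * exp (- 2 * \<alpha> * real n * (dx / lam))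
                    * msq (moments (lbm b C s2 s3 g n j))))
       \<le> ennreal (lam * B) * (\<Sum>n. ennreal ((dx / lam) * exp (- 2 * \<alpha> * real n * (dx / lam)) * (g n)^2))"
      unfolding L_def R_def dt_def .
  qed
qed

end

section \<open>Instability\<close>

text \<open>Cauchy-Schwarz with weight \<rho>^n split evenly: a weighted square sum bounds the
  generating function at \<rho> up to 1/(1 - \<rho>).\<close>

lemma weighted_sum_square_le:
  fixes m :: "nat \<Rightarrow> real"
  assumes \<rho>: "0 < \<rho>" "\<rho> < 1" and X: "\<And>N. (\<Sum>n<N. \<rho>^n * (m n)^2) \<le> X"
  shows "summable (\<lambda>n. \<bar>m n\<bar> * \<rho>^n)" "(\<Sum>n. \<bar>m n\<bar> * \<rho>^n)^2 \<le> X / (1 - \<rho>)"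
proof -
  have X0: "X \<ge> 0" using X[of 0] by simp
  have part: "(\<Sum>n<N. \<bar>m n\<bar> * \<rho>^n)^2 \<le> X / (1 - \<rho>)" for N
  proof -
    have sq: "(sqrt (\<rho>^n))^2 = \<rho>^n" for n using \<rho> by simp
    have "(\<Sum>n<N. \<bar>m n\<bar> * \<rho>^n)^2 = (\<Sum>n<N. (\<bar>m n\<bar> * sqrt (\<rho>^n)) * sqrt (\<rho>^n))^2"
      using \<rho> by (simp add: mult.assoc flip: real_sqrt_mult)
    also have "\<dots> \<le> (\<Sum>n<N. (\<bar>m n\<bar> * sqrt (\<rho>^n))^2) * (\<Sum>n<N. (sqrt (\<rho>^n))^2)"
      by (rule Cauchy_Schwarz_ineq_sum)
    also have "\<dots> = (\<Sum>n<N. \<rho>^n * (m n)^2) * (\<Sum>n<N. \<rho>^n)"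
      unfolding power_mult_distrib sq by (simp add: mult.commute)
    also have "\<dots> \<le> X * (1 / (1 - \<rho>))"
      using \<rho> X0 by (intro mult_mono X geometric_sum_le sum_nonneg) auto
    finally show ?thesis by simp
  qed
  have XX: "X / (1 - \<rho>) \<ge> 0" using X0 \<rho> by simp
  have part': "(\<Sum>n<N. \<bar>m n\<bar> * \<rho>^n) \<le> sqrt (X / (1 - \<rho>))" for N
    using part[of N] by (rule real_le_rsqrt)
  show s: "summable (\<lambda>n. \<bar>m n\<bar> * \<rho>^n)"
    using \<rho> part' by (intro summableI_nonneg_bounded[where x = "sqrt (X / (1 - \<rho>))"]) auto
  have "(\<Sum>n. \<bar>m n\<bar> * \<rho>^n) \<le> sqrt (X / (1 - \<rho>))" by (rule suminf_le_const[OF s part'])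
  moreover have "(\<Sum>n. \<bar>m n\<bar> * \<rho>^n) \<ge> 0" using \<rho> by (intro suminf_nonneg s) auto
  ultimately have "(\<Sum>n. \<bar>m n\<bar> * \<rho>^n)^2 \<le> (sqrt (X / (1 - \<rho>)))^2" by (rule power_mono)
  then show "(\<Sum>n. \<bar>m n\<bar> * \<rho>^n)^2 \<le> X / (1 - \<rho>)" using XX by simp
qed

lemma SS_imp_SSOO:
  assumes "SS_estimate b C s2 s3 lam" "lam > 0"
  shows "SSOO_estimate b C s2 s3 lam"
proof -
  obtain B where B: "B > 0" "\<And>\<alpha> g dx. \<alpha> > 0 \<Longrightarrow> dx > 0 \<Longrightarrow>
       ennreal (\<alpha> / (1 + \<alpha> * (dx / lam))) *
         (\<Sum>n. \<Sum>j. ennreal ((dx / lam) * dx * exp (- 2 * \<alpha> * real n * (dx / lam))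
                    * msq (moments (lbm b C s2 s3 g n j))))
       \<le> ennreal B * (\<Sum>n. ennreal ((dx / lam) * exp (- 2 * \<alpha> * real n * (dx / lam)) * (g n)^2))"
    using assms(1) unfolding SS_estimate_def by blast
  show ?thesis unfolding SSOO_estimate_def
  proof (intro exI[of _ B] conjI allI impI B(1))
    fix \<alpha> dx :: real and g :: "nat \<Rightarrow> real" assume \<alpha>: "\<alpha> > 0" and dx: "dx > 0"
    have "(\<Sum>n. \<Sum>j. ennreal ((dx / lam) * dx * exp (- 2 * \<alpha> * real n * (dx / lam))
              * (f1 (moments (lbm b C s2 s3 g n j)))^2))
      \<le> (\<Sum>n. \<Sum>j. ennreal ((dx / lam) * dx * exp (- 2 * \<alpha> * real n * (dx / lam))
              * msq (moments (lbm b C s2 s3 g n j))))"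
      using dx assms(2) by (intro suminf_le ennreal_leI mult_left_mono) (auto simp: msq_def)
    then show "ennreal (\<alpha> / (1 + \<alpha> * (dx / lam))) *
         (\<Sum>n. \<Sum>j. ennreal ((dx / lam) * dx * exp (- 2 * \<alpha> * real n * (dx / lam))
                    * (f1 (moments (lbm b C s2 s3 g n j)))^2))
       \<le> ennreal B * (\<Sum>n. ennreal ((dx / lam) * exp (- 2 * \<alpha> * real n * (dx / lam)) * (g n)^2))"
      using B(2)[OF \<alpha> dx, of g] by (meson mult_left_mono order_trans zero_le)
  qed
qed

context d1q3
begin

text \<open>Tests the estimate on the source g = 1 and keeps only the node j = 0. The generating
  function of m1 there is \<rho>/(1 - \<rho>) M1/KL, while the estimate allows its square to grow at
  most like (1 - \<rho>)^(-3); hence KL cannot decay faster than the square root of 1 - \<rho>, as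
  long as M1 does not vanish.\<close>

lemma SSOO_imp_KL_lower_bound:
  assumes lam: "lam > 0" and est: "SSOO_estimate b C s2 s3 lam"
  obtains B where "\<And>\<rho>. 0 < \<rho> \<Longrightarrow> \<rho> < 1 \<Longrightarrow>
    (\<rho> * norm (M1 (of_real \<rho>)))^2 * (1 - \<rho>) \<le> B * (norm (KL b (of_real \<rho>) (spatial_root (of_real \<rho>))))^2"
proof -
  let ?g = "\<lambda>n::nat. 1::real"
  define m where "m = (\<lambda>n. f1 (moments (lbm b C s2 s3 ?g n 0)))"
  obtain B where B: "B > 0" "\<And>\<alpha> g dx. \<alpha> > 0 \<Longrightarrow> dx > 0 \<Longrightarrow>
       ennreal (\<alpha> / (1 + \<alpha> * (dx / lam))) *
         (\<Sum>n. \<Sum>j. ennreal ((dx / lam) * dx * exp (- 2 * \<alpha> * real n * (dx / lam))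
                    * (f1 (moments (lbm b C s2 s3 g n j)))^2))
       \<le> ennreal B * (\<Sum>n. ennreal ((dx / lam) * exp (- 2 * \<alpha> * real n * (dx / lam)) * (g n)^2))"
    using est unfolding SSOO_estimate_def by blast
  have X: "(\<Sum>n<N. \<rho>^n * (m n)^2) \<le> 3 * B / (lam * (1 - \<rho>)^2)" if \<rho>: "0 < \<rho>" "\<rho> < 1" for \<rho> N
  proof -
    \<comment> \<open>Together with dx = lam, so that the time step is 1, this makes the exponential
      weight equal to \<rho>^n.\<close>
    define \<alpha> where "\<alpha> = - ln \<rho> / 2"
    have \<alpha>: "\<alpha> \<ge> (1 - \<rho>) / 2" using ln_le_minus_one[of \<rho>] \<rho> by (simp add: \<alpha>_def)
    have "0 < (1 - \<rho>) / 2" using \<rho> by simp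
    then have \<alpha>0: "\<alpha> > 0" using \<alpha> by (rule less_le_trans)
    have er: "exp (- 2 * \<alpha> * real n * (lam / lam)) = \<rho>^n" for n
    proof -
      have "- 2 * \<alpha> * real n * (lam / lam) = real n * ln \<rho>" using lam by (simp add: \<alpha>_def)
      then show ?thesis using \<rho> by (simp only: exp_of_nat_mult) simp
    qed
    have inst: "ennreal (\<alpha> / (1 + \<alpha>)) * (\<Sum>n. \<Sum>j. ennreal (lam * \<rho>^n * (f1 (moments (lbm b C s2 s3 ?g n j)))^2))
       \<le> ennreal B * (\<Sum>n. ennreal (\<rho>^n))"
      using B(2)[OF \<alpha>0 lam, of ?g] unfolding er using lam by simp
    have "(\<Sum>n<N. ennreal (lam * \<rho>^n * (m n)^2))
      \<le> (\<Sum>n<N. \<Sum>j. ennreal (lam * \<rho>^n * (f1 (moments (lbm b C s2 s3 ?g n j)))^2))"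
    proof (rule sum_mono)
      fix n
      have "(\<Sum>j\<in>{0}. ennreal (lam * \<rho>^n * (f1 (moments (lbm b C s2 s3 ?g n j)))^2))
        \<le> (\<Sum>j. ennreal (lam * \<rho>^n * (f1 (moments (lbm b C s2 s3 ?g n j)))^2))"
        by (rule sum_le_suminf) auto
      then show "ennreal (lam * \<rho>^n * (m n)^2)
        \<le> (\<Sum>j. ennreal (lam * \<rho>^n * (f1 (moments (lbm b C s2 s3 ?g n j)))^2))" by (simp add: m_def)
    qed
    also have "\<dots> \<le> (\<Sum>n. \<Sum>j. ennreal (lam * \<rho>^n * (f1 (moments (lbm b C s2 s3 ?g n j)))^2))"
      by (rule sum_le_suminf) auto
    finally have "ennreal (\<alpha> / (1 + \<alpha>)) * (\<Sum>n<N. ennreal (lam * \<rho>^n * (m n)^2))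
      \<le> ennreal (\<alpha> / (1 + \<alpha>)) * (\<Sum>n. \<Sum>j. ennreal (lam * \<rho>^n * (f1 (moments (lbm b C s2 s3 ?g n j)))^2))"
      by (rule mult_left_mono) simp
    also note inst
    also have "(\<Sum>n. ennreal (\<rho>^n)) = ennreal (1 / (1 - \<rho>))"
      using \<rho> by (subst suminf_ennreal2) (auto simp: suminf_geometric)
    also have "ennreal B * ennreal (1 / (1 - \<rho>)) = ennreal (B / (1 - \<rho>))"
      using \<rho> B(1) by (simp flip: ennreal_mult)
    also have "ennreal (\<alpha> / (1 + \<alpha>)) * (\<Sum>n<N. ennreal (lam * \<rho>^n * (m n)^2))
      = ennreal (\<alpha> / (1 + \<alpha>) * (lam * (\<Sum>n<N. \<rho>^n * (m n)^2)))"
    proof -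
      have "(\<Sum>n<N. ennreal (lam * \<rho>^n * (m n)^2)) = ennreal (\<Sum>n<N. lam * \<rho>^n * (m n)^2)"
        using lam \<rho> by (intro sum_ennreal) auto
      also have "(\<Sum>n<N. lam * \<rho>^n * (m n)^2) = lam * (\<Sum>n<N. \<rho>^n * (m n)^2)"
        by (simp add: sum_distrib_left mult.assoc)
      finally show ?thesis
        using \<alpha>0 lam \<rho> by (simp only:) (intro ennreal_mult[symmetric] mult_nonneg_nonneg sum_nonneg; simp)
    qed
    finally have le: "\<alpha> / (1 + \<alpha>) * (lam * (\<Sum>n<N. \<rho>^n * (m n)^2)) \<le> B / (1 - \<rho>)"
      using \<rho> B(1) by (simp add: ennreal_le_iff)
    \<comment> \<open>The 3 comes from 1 - \<rho> \<le> 2 \<alpha> and (1 - \<rho>) \<alpha> \<le>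
      \<alpha>.\<close>
    have "(1 - \<rho>) / 3 \<le> \<alpha> / (1 + \<alpha>)"
    proof -
      have "(1 - \<rho>) * \<alpha> \<le> 1 * \<alpha>" using \<rho> \<alpha>0 by (intro mult_right_mono) auto
      then have "(1 - \<rho>) * (1 + \<alpha>) \<le> 3 * \<alpha>" using \<alpha> by (simp add: algebra_simps)
      then show ?thesis using \<alpha>0 by (simp add: field_simps)
    qed
    then have "(1 - \<rho>) / 3 * (lam * (\<Sum>n<N. \<rho>^n * (m n)^2)) \<le> \<alpha> / (1 + \<alpha>) * (lam * (\<Sum>n<N. \<rho>^n * (m n)^2))"
      using lam \<rho> by (intro mult_right_mono mult_nonneg_nonneg sum_nonneg) auto
    then have "(1 - \<rho>) / 3 * (lam * (\<Sum>n<N. \<rho>^n * (m n)^2)) \<le> B / (1 - \<rho>)" using le by linarith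
    then have "(1 - \<rho>) / 3 * (lam * (\<Sum>n<N. \<rho>^n * (m n)^2)) * (1 - \<rho>) \<le> B"
      using \<rho> by (simp only: pos_le_divide_eq diff_gt_0_iff_gt)
    then have "(\<Sum>n<N. \<rho>^n * (m n)^2) * (lam * (1 - \<rho>)^2) \<le> 3 * B"
      by (simp add: power2_eq_square mult_ac)
    moreover have "lam * (1 - \<rho>)^2 > 0" using lam \<rho> by simp
    ultimately show ?thesis by (simp only: pos_le_divide_eq)
  qed
  define P where "P = f1 (smul3 (ampl b ?g * K^0) (moments modeF))"
  have Pn: "fps_nth P n = of_real (m n)" for n
    using arg_cong[OF moments_lbm[of b ?g n 0], of f1] by (simp add: nth3_def m_def cplx3_def P_def)
  have Psum: "summable (\<lambda>n. norm (fps_nth P n * of_real \<rho> ^ n))"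
    "norm (eval_fps P (of_real \<rho>))^2 \<le> 3 * B / (lam * (1 - \<rho>)^3)" if \<rho>: "0 < \<rho>" "\<rho> < 1" for \<rho>
  proof -
    have eq: "norm (fps_nth P n * of_real \<rho> ^ n) = \<bar>m n\<bar> * \<rho>^n" for n
      using \<rho> by (simp add: Pn norm_mult norm_power)
    note w = weighted_sum_square_le[OF \<rho> X[OF \<rho>]]
    show s: "summable (\<lambda>n. norm (fps_nth P n * of_real \<rho> ^ n))" unfolding eq by (rule w(1))
    have "norm (eval_fps P (of_real \<rho>)) \<le> (\<Sum>n. \<bar>m n\<bar> * \<rho>^n)"
      unfolding eval_fps_def eq[symmetric] by (rule summable_norm[OF s])
    then have "norm (eval_fps P (of_real \<rho>))^2 \<le> (\<Sum>n. \<bar>m n\<bar> * \<rho>^n)^2" by (rule power_mono) simp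
    also have "\<dots> \<le> 3 * B / (lam * (1 - \<rho>)^2) / (1 - \<rho>)" by (rule w(2))
    finally show "norm (eval_fps P (of_real \<rho>))^2 \<le> 3 * B / (lam * (1 - \<rho>)^3)"
      by (simp add: power3_eq_cube power2_eq_square mult.assoc)
  qed
  \<comment> \<open>The formal quotient by KL could have a smaller radius; convergence on the whole
    disc is a consequence of the assumed estimate.\<close>
  have Pconv: "fps_conv_radius P \<ge> 1"
    unfolding fps_conv_radius_def
  proof (rule conv_radius_geI_ex')
    fix r :: real assume r: "0 < r" "ereal r < 1"
    then have "r < 1" by simp
    show "summable (\<lambda>n. fps_nth P n * of_real r ^ n)"
      by (rule summable_norm_cancel) (rule Psum(1)[OF r(1) \<open>r < 1\<close>])
  qed
  \<comment> \<open>The product form avoids dividing by KL, so its possible zeros in the disc do no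
    harm.\<close>
  define G where "G = fps_X * Abs_fps (\<lambda>n. of_real (?g n) :: complex)"
  define M where "M = f1 (moments modeF)"
  have prod: "P * KLF b = G * M"
    using ampl_KLF[of b ?g] by (simp add: P_def G_def M_def mult_ac)
  have ballc: "ball (0::complex) 1 = eball 0 1" by (simp add: one_ereal_def)
  have M: "(\<lambda>w. f1 (moments (root_mode w))) has_fps_expansion M"
    using has_expansion3_moments[OF has_expansion_mode] by (simp add: M_def has_expansion3_def)
  then have M: "M1 has_fps_expansion M" unfolding moments_mode f_simps .
  have Gh: "(\<lambda>w. w * (1 / (1 - w))) has_fps_expansion G"
  proof -
    have "(\<lambda>w::complex. 1 / (1 - w)) has_fps_expansion 1 / (1 - fps_X)"
      by (intro fps_expansion_intros) auto
    also have "1 / (1 - fps_X) = Abs_fps (\<lambda>n. of_real (?g n) :: complex)"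
    proof -
      have "inverse (1 - fps_X) = (Abs_fps (\<lambda>n. 1) :: complex fps)"
        by (subst fps_inverse_gp'[symmetric], rule fps_inverse_idempotent) simp
      then show ?thesis by (simp add: fps_divide_unit)
    qed
    finally show ?thesis unfolding G_def by (intro fps_expansion_intros)
  qed
  have Ghol: "(\<lambda>w. w * (1 / (1 - w))) holomorphic_on eball 0 1"
    unfolding ballc[symmetric] by (intro holomorphic_intros) auto
  have KLhol: "(\<lambda>w. KL b w (spatial_root w)) holomorphic_on eball 0 1"
    unfolding ballc[symmetric] by (rule holomorphic_KL)
  have main: "eval_fps P (of_real \<rho>) * KL b (of_real \<rho>) (spatial_root (of_real \<rho>))
      = of_real \<rho> / (1 - of_real \<rho>) * M1 (of_real \<rho>)" if \<rho>: "0 < \<rho>" "\<rho> < 1" for \<rho>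
  proof -
    let ?w = "complex_of_real \<rho>"
    have nw: "ereal (norm ?w) < 1" using \<rho> by (simp add: one_ereal_def)
    have cK: "fps_conv_radius (KLF b) \<ge> 1" by (rule holomorphic_on_imp_fps_conv_radius_ge[OF has_expansion_KL KLhol])
    have cG: "fps_conv_radius G \<ge> 1" by (rule holomorphic_on_imp_fps_conv_radius_ge[OF Gh Ghol])
    have cM: "fps_conv_radius M \<ge> 1" by (rule holomorphic_on_imp_fps_conv_radius_ge[OF M holomorphic_M1])
    have eK: "eval_fps (KLF b) ?w = KL b ?w (spatial_root ?w)"
      using has_fps_expansion_imp_sums_complex[OF has_expansion_KL KLhol nw]
      by (simp add: eval_fps_def sums_iff)
    have eG: "eval_fps G ?w = ?w * (1 / (1 - ?w))"
      using has_fps_expansion_imp_sums_complex[OF Gh Ghol nw] by (simp add: eval_fps_def sums_iff)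
    have eM: "eval_fps M ?w = M1 ?w"
      using has_fps_expansion_imp_sums_complex[OF M holomorphic_M1 nw] by (simp add: eval_fps_def sums_iff)
    have "eval_fps P ?w * eval_fps (KLF b) ?w = eval_fps (P * KLF b) ?w"
      by (rule eval_fps_mult[symmetric]) (rule less_le_trans[OF nw Pconv] less_le_trans[OF nw cK])+
    also have "\<dots> = eval_fps G ?w * eval_fps M ?w"
      unfolding prod by (rule eval_fps_mult) (rule less_le_trans[OF nw cG] less_le_trans[OF nw cM])+
    finally show ?thesis unfolding eK eG eM by simp
  qed
  show thesis
  proof (rule that[of "3 * B / lam"])
    fix \<rho> :: real assume \<rho>: "0 < \<rho>" "\<rho> < 1"
    let ?w = "complex_of_real \<rho>"
    have n1: "norm (1 - ?w) = 1 - \<rho>"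
      using \<rho> by (metis abs_of_pos diff_gt_0_iff_gt norm_of_real of_real_1 of_real_diff)
    have "norm (eval_fps P ?w) * norm (KL b ?w (spatial_root ?w)) = \<rho> * norm (M1 ?w) / (1 - \<rho>)"
      using arg_cong[OF main[OF \<rho>], of norm] \<rho> by (simp add: norm_mult norm_divide n1)
    then have "(\<rho> * norm (M1 ?w))^2 = (norm (eval_fps P ?w))^2 * (norm (KL b ?w (spatial_root ?w)))^2 * (1 - \<rho>)^2"
    proof -
      assume eq: "norm (eval_fps P ?w) * norm (KL b ?w (spatial_root ?w)) = \<rho> * norm (M1 ?w) / (1 - \<rho>)"
      have "\<rho> * norm (M1 ?w) = norm (eval_fps P ?w) * norm (KL b ?w (spatial_root ?w)) * (1 - \<rho>)"
        unfolding eq using \<rho> by simp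
      then show ?thesis by (simp only: power_mult_distrib)
    qed
    also have "\<dots> \<le> 3 * B / (lam * (1 - \<rho>)^3) * (norm (KL b ?w (spatial_root ?w)))^2 * (1 - \<rho>)^2"
      using Psum(2)[OF \<rho>] by (intro mult_right_mono) auto
    finally have "(\<rho> * norm (M1 ?w))^2 * (1 - \<rho>)
      \<le> 3 * B / (lam * (1 - \<rho>)^3) * (norm (KL b ?w (spatial_root ?w)))^2 * (1 - \<rho>)^2 * (1 - \<rho>)"
      using \<rho> by (intro mult_right_mono) auto
    also have "\<dots> = 3 * B / lam * (norm (KL b ?w (spatial_root ?w)))^2"
    proof -
      have "3 * B / (lam * q^3) * k * q^2 * q = 3 * B / lam * k" if "q \<noteq> 0" for q k
        using that lam by (simp add: field_simps power2_eq_square power3_eq_cube)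
      then show ?thesis using \<rho> by simp
    qed
    finally show "(\<rho> * norm (M1 ?w))^2 * (1 - \<rho>) \<le> 3 * B / lam * (norm (KL b ?w (spatial_root ?w)))^2" .
  qed
qed

text \<open>Linear decay of KL beats the admissible square-root rate, because M1 tends to s3, which
  is not 0.\<close>

lemma not_SSOO:
  assumes lam: "lam > 0" and \<rho>: "\<And>n. 0 < \<rho> n" "\<And>n. \<rho> n < 1" "\<rho> \<longlonglongrightarrow> 1"
    and small: "\<forall>\<^sub>F n in sequentially.
      norm (KL b (of_real (\<rho> n)) (spatial_root (of_real (\<rho> n)))) \<le> D * (1 - \<rho> n)"
  shows "\<not> SSOO_estimate b C s2 s3 lam"
proof
  assume "SSOO_estimate b C s2 s3 lam"
  then obtain B where B: "\<And>\<rho>. 0 < \<rho> \<Longrightarrow> \<rho> < 1 \<Longrightarrow>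
    (\<rho> * norm (M1 (of_real \<rho>)))^2 * (1 - \<rho>) \<le> B * (norm (KL b (of_real \<rho>) (spatial_root (of_real \<rho>))))^2"
    using SSOO_imp_KL_lower_bound[OF lam] by blast
  have "\<forall>\<^sub>F n in sequentially. (\<rho> n * norm (M1 (of_real (\<rho> n))))^2 \<le> \<bar>B\<bar> * D^2 * (1 - \<rho> n)"
    using small
  proof eventually_elim
    case (elim n)
    let ?k = "norm (KL b (of_real (\<rho> n)) (spatial_root (of_real (\<rho> n))))"
    have "?k^2 \<le> (D * (1 - \<rho> n))^2" using elim by (intro power_mono) auto
    then have "\<bar>B\<bar> * ?k^2 \<le> \<bar>B\<bar> * (D * (1 - \<rho> n))^2" by (intro mult_left_mono) auto
    moreover have "B * ?k^2 \<le> \<bar>B\<bar> * ?k^2" by (intro mult_right_mono) auto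
    ultimately have "(\<rho> n * norm (M1 (of_real (\<rho> n))))^2 * (1 - \<rho> n) \<le> \<bar>B\<bar> * (D * (1 - \<rho> n))^2"
      using B[OF \<rho>(1,2)[of n]] by linarith
    also have "\<dots> = \<bar>B\<bar> * D^2 * (1 - \<rho> n) * (1 - \<rho> n)" by (simp add: power2_eq_square)
    finally show ?case using \<rho>(2)[of n] by simp
  qed
  moreover have "(\<lambda>n. \<bar>B\<bar> * D^2 * (1 - \<rho> n)) \<longlonglongrightarrow> \<bar>B\<bar> * D^2 * (1 - 1)" by (intro tendsto_intros \<rho>(3))
  moreover have "(\<lambda>n. (\<rho> n * norm (M1 (of_real (\<rho> n))))^2) \<longlonglongrightarrow> (1 * norm (M1 (of_real 1)))^2"
    unfolding M1_def by (intro tendsto_intros \<rho>(3))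
  ultimately have "(1 * norm (M1 (of_real 1)))^2 \<le> \<bar>B\<bar> * D^2 * (1 - 1)"
    by (intro tendsto_le[OF sequentially_bot])
  then show False using M1_nz[of 1] by simp
qed

text \<open>Compactness of \<open>stable_set\<close> replaces continuity of the root at w = 1: some
  subsequence of a real sequence converges, its limit stays in the set, and the sequence itself
  witnesses \<open>limit_of_stable_root\<close>.\<close>

lemma limit_at_1:
  obtains \<rho> :: "nat \<Rightarrow> real" and k where "\<And>n. 0 < \<rho> n" "\<And>n. \<rho> n < 1" "\<rho> \<longlonglongrightarrow> 1"
    "(\<lambda>n. spatial_root (of_real (\<rho> n))) \<longlonglongrightarrow> k" "(1, k) \<in> stable_set" "limit_of_stable_root C s2 s3 1 k"
proof -
  define x where "x = (\<lambda>n. 1 - 1 / (real n + 2))"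
  have x: "0 < x n" "x n < 1" for n by (auto simp: x_def)
  have xlim: "x \<longlonglongrightarrow> 1" unfolding x_def by real_asymp
  define y where "y = (\<lambda>n. (complex_of_real (x n), spatial_root (of_real (x n))))"
  have "y n \<in> stable_set" for n unfolding y_def using x[of n] by (intro spatial_root(4)) simp
  then obtain l \<sigma> where l: "l \<in> stable_set" "strict_mono \<sigma>" "(y \<circ> \<sigma>) \<longlonglongrightarrow> l"
    using compact_stable_set unfolding compact_eq_seq_compact_metric seq_compact_def by blast
  define \<rho> where "\<rho> = x \<circ> \<sigma>"
  have \<rho>: "0 < \<rho> n" "\<rho> n < 1" for n using x by (auto simp: \<rho>_def)
  have \<rho>lim: "\<rho> \<longlonglongrightarrow> 1" unfolding \<rho>_def by (rule LIMSEQ_subseq_LIMSEQ[OF xlim l(2)])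
  then have cl: "(\<lambda>n. complex_of_real (\<rho> n)) \<longlonglongrightarrow> 1" using tendsto_of_real by fastforce
  have yl: "(\<lambda>n. (complex_of_real (\<rho> n), spatial_root (of_real (\<rho> n)))) \<longlonglongrightarrow> l"
    using l(3) by (simp add: y_def \<rho>_def comp_def)
  have k: "(\<lambda>n. spatial_root (of_real (\<rho> n))) \<longlonglongrightarrow> snd l" using tendsto_snd[OF yl] by simp
  have "fst l = 1" using tendsto_fst[OF yl] cl by (simp add: LIMSEQ_unique)
  then have l1: "(1, snd l) \<in> stable_set" using l(1) by (metis prod.collapse)
  have "limit_of_stable_root C s2 s3 1 (snd l)"
    unfolding limit_of_stable_root_def
  proof (intro exI conjI allI)
    fix n
    have w: "norm (complex_of_real (\<rho> n)) < 1" "complex_of_real (\<rho> n) \<noteq> 0" using \<rho>[of n] by auto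
    show "1 < cmod (1 / of_real (\<rho> n))" using \<rho>[of n] by (simp add: norm_divide)
    show "cmod (spatial_root (of_real (\<rho> n))) < 1" using spatial_root(3)[OF w(1)] .
    show "bulk_mode C s2 s3 (1 / of_real (\<rho> n)) (spatial_root (of_real (\<rho> n))) (root_mode (of_real (\<rho> n)))"
      using bulk_mode_mode[OF stable_setD[OF spatial_root(4)[OF w(1)]] w(2)] .
  next
    show "(\<lambda>n. 1 / complex_of_real (\<rho> n)) \<longlonglongrightarrow> 1" using tendsto_divide[OF tendsto_const cl, of 1] by simp
    show "(\<lambda>n. spatial_root (complex_of_real (\<rho> n))) \<longlonglongrightarrow> snd l" by (rule k)
  qed
  then show thesis using that \<rho> \<rho>lim k l1 by blast
qed

lemma critical_mode_1:
  assumes "(1, k) \<in> stable_set" "limit_of_stable_root C s2 s3 1 k" "KL b 1 k = 0"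
  shows "critical_mode b C s2 s3 1 k"
proof -
  have "bulk_mode C s2 s3 1 k (mode 1 k)" using bulk_mode_mode[OF stable_setD[OF assms(1)]] by simp
  then show ?thesis using assms(2,3) unfolding critical_mode_def KL_def
    by (intro conjI exI[of _ "mode 1 k"]) auto
qed

text \<open>For C < 0 the limit root is not 1, so it solves \<open>disp_a 1 * k = disp_b 1\<close>
  and is localised. Since 1 - \<kappa> stays away from 0, the identity for KL (1 - \<kappa>) yields
  linear decay.\<close>

lemma BounceBack_MU_L:
  assumes lam: "lam > 0" and Cn: "C < 0"
  shows "label_MU_L BounceBack C s2 s3 lam"
proof -
  obtain \<rho> k where \<rho>: "\<And>n. 0 < \<rho> n" "\<And>n. \<rho> n < 1" "\<rho> \<longlonglongrightarrow> 1"
    and k: "(\<lambda>n. spatial_root (of_real (\<rho> n))) \<longlonglongrightarrow> k" "(1, k) \<in> stable_set" "limit_of_stable_root C s2 s3 1 k"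
    using limit_at_1 by blast
  have k1: "k \<noteq> 1" using KL_nz(5)[OF k(2) Cn] .
  have "KL BounceBack 1 k * (1 - k) = 0" using KL_BounceBack[OF stable_setD[OF k(2)]] by simp
  then have crit: "critical_mode BounceBack C s2 s3 1 k" using k1 by (intro critical_mode_1 k) simp
  have "disp_a 1 * k = disp_b 1" using disp_at_1[OF stable_setD(3)[OF k(2)]] k1 by simp
  then have "norm (disp_a 1) * norm k < norm (disp_a 1) * 1"
    using norm_disp_at_1(1)[OF Cn] by (metis mult.right_neutral norm_mult)
  then have kl: "norm k < 1" by (rule mult_left_less_imp_less) simp
  define d where "d = norm (1 - k) / 2"
  have d: "0 < d" using k1 by (simp add: d_def)
  have "(\<lambda>n. norm (1 - spatial_root (of_real (\<rho> n)))) \<longlonglongrightarrow> norm (1 - k)" by (intro tendsto_intros k)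
  moreover have "d < norm (1 - k)" using d by (simp add: d_def)
  ultimately have ev: "\<forall>\<^sub>F n in sequentially. d < norm (1 - spatial_root (of_real (\<rho> n)))" by (rule order_tendstoD)
  have "\<forall>\<^sub>F n in sequentially. norm (KL BounceBack (of_real (\<rho> n)) (spatial_root (of_real (\<rho> n)))) \<le> 2 / d * (1 - \<rho> n)"
    using ev
  proof eventually_elim
    case (elim n)
    let ?w = "complex_of_real (\<rho> n)"
    have w: "norm ?w < 1" using \<rho>(1,2)[of n] by simp
    have M1: "norm (M1 ?w) \<le> 2"
    proof -
      have "norm (M1 ?w) \<le> norm (1::complex) + norm (of_real (1 - s3) * ?w)" unfolding M1_def by (rule norm_triangle_ineq4)
      also have "norm (of_real (1 - s3) * ?w) \<le> 1 * 1"
        unfolding norm_mult norm_of_real using norm_s3 w by (intro mult_mono) auto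
      finally show ?thesis by simp
    qed
    have n1: "norm (1 - ?w) = 1 - \<rho> n"
      using \<rho>(2)[of n] by (metis abs_of_pos diff_gt_0_iff_gt norm_of_real of_real_1 of_real_diff)
    have "norm (KL BounceBack ?w (spatial_root ?w)) * d
      \<le> norm (KL BounceBack ?w (spatial_root ?w)) * norm (1 - spatial_root ?w)"
      using elim by (intro mult_left_mono) auto
    also have "\<dots> = (1 - \<rho> n) * norm (M1 ?w)"
      using KL_BounceBack[OF stable_setD[OF spatial_root(4)[OF w]]] by (metis n1 norm_mult)
    also have "\<dots> \<le> (1 - \<rho> n) * 2" using M1 \<rho>(2)[of n] by (intro mult_left_mono) auto
    finally show ?case using d by (simp add: field_simps)
  qed
  from not_SSOO[OF lam \<rho> this] have "\<not> SSOO_estimate BounceBack C s2 s3 lam" .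
  then show ?thesis unfolding label_MU_L_def using SS_imp_SSOO[OF _ lam] crit kl by blast
qed

text \<open>For C > 0 the only root in the closed disc at w = 1 is k = 1. The symmetrised dispersion
  relation shows that 1 - \<kappa> is of order 1 - w, and KL contains at least one factor 1 -
  \<kappa>.\<close>

lemma Extrapolation_MU_E:
  assumes lam: "lam > 0" and Cp: "C > 0" and \<sigma>: "\<sigma> \<ge> 1"
  shows "label_MU_E (Extrapolation \<sigma>) C s2 s3 lam"
proof -
  obtain \<rho> k where \<rho>: "\<And>n. 0 < \<rho> n" "\<And>n. \<rho> n < 1" "\<rho> \<longlonglongrightarrow> 1"
    and k: "(\<lambda>n. spatial_root (of_real (\<rho> n))) \<longlonglongrightarrow> k" "(1, k) \<in> stable_set" "limit_of_stable_root C s2 s3 1 k"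
    using limit_at_1 by blast
  have k1: "k = 1"
  proof (rule ccontr)
    assume "k \<noteq> 1"
    then have "disp_a 1 * k = disp_b 1" using disp_at_1[OF stable_setD(3)[OF k(2)]] by simp
    then have "norm (disp_b 1) \<le> norm (disp_a 1)"
      using stable_setD(2)[OF k(2)] by (metis mult_left_le norm_ge_zero norm_mult)
    then show False using norm_disp_at_1(2)[OF Cp] by simp
  qed
  have "KL (Extrapolation \<sigma>) 1 k = 0"
    using KL_Extrapolation[OF stable_setD[OF k(2)]] k1 \<sigma> by simp
  then have crit: "critical_mode (Extrapolation \<sigma>) C s2 s3 1 k" by (intro critical_mode_1 k)
  define w where "w = (\<lambda>n. complex_of_real (\<rho> n))"
  define x where "x = (\<lambda>n. spatial_root (w n))"
  have wl: "w \<longlonglongrightarrow> 1" using tendsto_of_real[OF \<rho>(3)] by (simp add: w_def)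
  have xl: "x \<longlonglongrightarrow> 1" using k(1) k1 by (simp add: x_def w_def)
  have w1: "norm (w n) < 1" for n using \<rho>(1,2)[of n] by (simp add: w_def)
  have n1: "norm (1 - w n) = 1 - \<rho> n" for n
    using \<rho>(2)[of n] unfolding w_def by (metis abs_of_pos diff_gt_0_iff_gt norm_of_real of_real_1 of_real_diff)
  define a where "a = complex_of_real (1 - s2)"
  \<comment> \<open>The symmetrised relation solved for the factor 1 - x: L tends to 4 s2 C M1(1),
    which is nonzero, and R is bounded.\<close>
  define L where "L = (\<lambda>n. (1 - x n) * (1 + a * w n) * (M3 (w n) + w n * M3s (w n))
    + 2 * (1 + x n) * w n * of_real (s2 * C) * M1 (w n))"
  define R where "R = (\<lambda>n. (1 + x n)^2 * (1 - a * w n) * M1 (w n))"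
  have LR: "(1 - x n) * L n = (1 - w n) * R n" for n
  proof -
    have "disp (w n) (x n)" unfolding x_def by (rule stable_setD(3)[OF spatial_root(4)[OF w1]])
    then have "(1 + x n)^2 * (1 - a * w n) * ((1 - w n) * M1 (w n))
      - (1 - x n)^2 * (1 + a * w n) * (M3 (w n) + w n * M3s (w n))
      - 2 * (1 - (x n)^2) * w n * of_real (s2 * C) * M1 (w n) = 0"
      using disp_symmetrised[of "x n" "w n"] by (simp add: disp_def a_def)
    then show ?thesis unfolding L_def R_def by (simp add: algebra_simps power2_eq_square)
  qed
  have "L \<longlonglongrightarrow> (1 - 1) * (1 + a * 1) * (M3 1 + 1 * M3s 1) + 2 * (1 + 1) * 1 * of_real (s2 * C) * M1 1"
    unfolding L_def M1_def M3_def M3s_def by (intro tendsto_intros wl xl)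
  then have "L \<longlonglongrightarrow> 4 * of_real (s2 * C) * M1 1" by simp
  then have "(\<lambda>n. norm (L n)) \<longlonglongrightarrow> norm (4 * of_real (s2 * C) * M1 1)" by (rule tendsto_norm)
  moreover define d where "d = norm (4 * of_real (s2 * C) * M1 1) / 2"
  moreover have d: "d > 0" using s2 Cp M1_nz[of 1] by (auto simp: d_def)
  moreover have "d < norm (4 * of_real (s2 * C) * M1 1)" using d by (simp add: d_def)
  ultimately have evL: "\<forall>\<^sub>F n in sequentially. d < norm (L n)" by (metis order_tendstoD(1))
  have "R \<longlonglongrightarrow> (1 + 1)^2 * (1 - a * 1) * M1 1"
    unfolding R_def M1_def by (intro tendsto_intros wl xl)
  then have "convergent R" by (rule convergentI)
  then obtain r where r: "\<And>n. norm (R n) \<le> r"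
    using convergent_imp_Bseq BseqD by blast
  \<comment> \<open>The kinetic determinant is f2 of the mode, so its continuity on the compact set
    bounds the factor f2 of the extrapolation determinant.\<close>
  have "bounded ((\<lambda>y. KL KineticDirichlet (fst y) (snd y)) ` stable_set)"
    using compact_continuous_image[OF continuous_on_KL compact_stable_set] compact_imp_bounded by blast
  then obtain f where f: "\<And>y. y \<in> stable_set \<Longrightarrow> norm (KL KineticDirichlet (fst y) (snd y)) \<le> f"
    unfolding bounded_iff by auto
  have "\<forall>\<^sub>F n in sequentially. norm (KL (Extrapolation \<sigma>) (of_real (\<rho> n)) (spatial_root (of_real (\<rho> n))))
    \<le> f * 2^(\<sigma> - 1) * (r / d) * (1 - \<rho> n)"
    using evL
  proof eventually_elim
    case (elim n)
    have m: "(w n, x n) \<in> stable_set" unfolding x_def by (rule spatial_root(4)[OF w1])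
    have ff: "norm (f2 (mode (w n) (x n))) \<le> f" using f[OF m] by (simp add: KL_Kinetic)
    have "norm (1 - x n) * d \<le> norm (1 - x n) * norm (L n)" using elim by (intro mult_left_mono) auto
    also have "\<dots> = (1 - \<rho> n) * norm (R n)" using LR[of n] by (metis n1 norm_mult)
    also have "\<dots> \<le> (1 - \<rho> n) * r" using r \<rho>(2)[of n] by (intro mult_left_mono) auto
    finally have x1: "norm (1 - x n) \<le> r / d * (1 - \<rho> n)" using d by (simp add: field_simps)
    have x2: "norm (1 - x n) \<le> 2"
      using norm_triangle_ineq4[of 1 "x n"] stable_setD(2)[OF m] by simp
    \<comment> \<open>One factor supplies the decay; the other \<sigma> - 1 are bounded by
      2.\<close>
    have "norm (1 - x n)^\<sigma> = norm (1 - x n)^(\<sigma> - 1) * norm (1 - x n)" using \<sigma> by (simp flip: power_Suc2)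
    also have "\<dots> \<le> 2^(\<sigma> - 1) * (r / d * (1 - \<rho> n))"
      using x1 x2 by (intro mult_mono power_mono) auto
    finally have "norm (1 - x n)^\<sigma> \<le> 2^(\<sigma> - 1) * (r / d * (1 - \<rho> n))" .
    then have "norm (f2 (mode (w n) (x n))) * norm (1 - x n)^\<sigma> \<le> f * (2^(\<sigma> - 1) * (r / d * (1 - \<rho> n)))"
      using ff by (intro mult_mono) (auto intro: order_trans[OF norm_ge_zero])
    moreover have "norm (KL (Extrapolation \<sigma>) (of_real (\<rho> n)) (spatial_root (of_real (\<rho> n))))
      = norm (f2 (mode (w n) (x n))) * norm (1 - x n)^\<sigma>"
      using KL_Extrapolation[OF stable_setD[OF m], of \<sigma>] by (simp add: x_def w_def norm_mult norm_power)
    ultimately show ?case by (simp only: mult.assoc)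
  qed
  from not_SSOO[OF lam \<rho> this] have "\<not> SSOO_estimate (Extrapolation \<sigma>) C s2 s3 lam" .
  then show ?thesis unfolding label_MU_E_def using SS_imp_SSOO[OF _ lam] crit k1 by (metis norm_one)
qed

end

theorem mainTheorem7:
  fixes C s2 s3 lam :: real
  assumes "lam > 0"
    and "C \<in> {-1<..<0} \<union> {0<..<1}"
    and "0 < s2" and "s2 < 2" and "0 < s3" and "s3 < 2"
    and "s3 \<le> s3_star s2"
  shows "(C < 0 \<longrightarrow>
            label_MU_L BounceBack C s2 s3 lam \<and>
            label_SS AntiBounceBack C s2 s3 lam \<and>
            label_SS TwoStepsAntiBounceBack C s2 s3 lam \<and>
            (\<forall>\<sigma>\<in>{1..4}. label_SS (Extrapolation \<sigma>) C s2 s3 lam) \<and>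
            label_SS KineticDirichlet C s2 s3 lam)
       \<and> (C > 0 \<longrightarrow>
            label_SS BounceBack C s2 s3 lam \<and>
            label_SS AntiBounceBack C s2 s3 lam \<and>
            label_SS TwoStepsAntiBounceBack C s2 s3 lam \<and>
            (\<forall>\<sigma>\<in>{1..4}. label_MU_E (Extrapolation \<sigma>) C s2 s3 lam) \<and>
            label_SS KineticDirichlet C s2 s3 lam)"
proof -
  interpret d1q3 C s2 s3
    using assms s3_star_imp[OF assms(3-7)] by unfold_locales auto
  note SSI = SS_estimateI[OF assms(1), folded label_SS_def]
  show ?thesis
    using BounceBack_MU_L[OF assms(1)] Extrapolation_MU_E[OF assms(1)]
      SSI[OF KL_nz(1)] SSI[OF KL_nz(2)] SSI[OF KL_nz(3)] SSI[OF KL_nz(4)] SSI[OF KL_nz(6)]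
    by auto
qed

end
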